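(* Let $R$ be a commutative Noetherian ring, $I$ a regular ideal of $R$ and $M$ a finitely generated $R$-module. If $\operatorname{ann} M=0$ then $\mathcal{F}^I_M=\{r(I^n,M)\}_{n\geq 0}$ is a stable $I$-filtration.
   Context: An ideal is regular if it contains a nonzerodivisor of $R$. For submodules $A,B$ of $M$, $(A:B)=\{x\in R : xB\subseteq A\}$, and for an ideal $L$ of $R$, $r(L,M)=\bigcup_{k\geq 1}(L^{k+1}M:L^kM)$ (an ascending union of ideals). For $n\ge1$, $r(I^n,M)=\bigcup_{k\geq 1}(I^{n+k}M:I^kM)$, and $r(I^0,M)=R$. A filtration of ideals $R=I_0\supseteq I_1\supseteq I_2\supseteq\cdots$ is a stable $I$-filtration if $I\,I_n\subseteq I_{n+1}$ for all $n\geq 0$ and $I\,I_n=I_{n+1}$ for all $n\gg 0$. *)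

theory Defs
  imports "HOL-Algebra.Ring_Divisibility" "HOL-Algebra.Ideal_Product" "HOL-Algebra.Module"
begin

definition nonzerodivisor :: "('a, 'c) ring_scheme \<Rightarrow> 'a \<Rightarrow> bool" where
  "nonzerodivisor R x \<longleftrightarrow>
     x \<in> carrier R \<and> (\<forall>y\<in>carrier R. x \<otimes>\<^bsub>R\<^esub> y = \<zero>\<^bsub>R\<^esub> \<longrightarrow> y = \<zero>\<^bsub>R\<^esub>)"

definition regular_ideal :: "('a, 'c) ring_scheme \<Rightarrow> 'a set \<Rightarrow> bool" where
  "regular_ideal R I \<longleftrightarrow> ideal I R \<and> (\<exists>x\<in>I. nonzerodivisor R x)"

definition gen_submodule ::
  "('a, 'c) ring_scheme \<Rightarrow> ('a, 'b, 'd) module_scheme \<Rightarrow> 'b set \<Rightarrow> 'b set" where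
  "gen_submodule R M S = \<Inter>{N. submodule N R M \<and> S \<subseteq> N}"

definition fg_module :: "('a, 'c) ring_scheme \<Rightarrow> ('a, 'b, 'd) module_scheme \<Rightarrow> bool" where
  "fg_module R M \<longleftrightarrow>
     module R M \<and> (\<exists>S. finite S \<and> S \<subseteq> carrier M \<and> carrier M = gen_submodule R M S)"

definition ann :: "('a, 'c) ring_scheme \<Rightarrow> ('a, 'b, 'd) module_scheme \<Rightarrow> 'a set" where
  "ann R M = {a \<in> carrier R. \<forall>x\<in>carrier M. a \<odot>\<^bsub>M\<^esub> x = \<zero>\<^bsub>M\<^esub>}"

definition ideal_mod ::
  "('a, 'c) ring_scheme \<Rightarrow> ('a, 'b, 'd) module_scheme \<Rightarrow> 'a set \<Rightarrow> 'b set" where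
  "ideal_mod R M L = gen_submodule R M {a \<odot>\<^bsub>M\<^esub> x | a x. a \<in> L \<and> x \<in> carrier M}"

definition colon ::
  "('a, 'c) ring_scheme \<Rightarrow> ('a, 'b, 'd) module_scheme \<Rightarrow> 'b set \<Rightarrow> 'b set \<Rightarrow> 'a set" where
  "colon R M A B = {x \<in> carrier R. \<forall>b\<in>B. x \<odot>\<^bsub>M\<^esub> b \<in> A}"

text \<open>\<open>ideals_set R\<close> is the multiplicative monoid of ideals, with unit \<open>carrier R\<close>;
  in particular the zeroth power of any ideal is the whole ring.\<close>

abbreviation ideal_pow :: "('a, 'c) ring_scheme \<Rightarrow> 'a set \<Rightarrow> nat \<Rightarrow> 'a set" where
  "ideal_pow R L n \<equiv> L [^]\<^bsub>ideals_set R\<^esub> n"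

text \<open>\<open>ideal_mod R M L\<close> is \<open>LM\<close>, \<open>colon R M A B\<close> is \<open>(A : B)\<close>, and \<open>rr_ideal R M L\<close>
  is \<open>r(L, M)\<close>.\<close>

definition rr_ideal ::
  "('a, 'c) ring_scheme \<Rightarrow> ('a, 'b, 'd) module_scheme \<Rightarrow> 'a set \<Rightarrow> 'a set" where
  "rr_ideal R M L =
     (\<Union>k\<in>{1::nat..}. colon R M (ideal_mod R M (ideal_pow R L (k + 1)))
                               (ideal_mod R M (ideal_pow R L k)))"

definition stable_filtration ::
  "('a, 'c) ring_scheme \<Rightarrow> 'a set \<Rightarrow> (nat \<Rightarrow> 'a set) \<Rightarrow> bool" where
  "stable_filtration R I F \<longleftrightarrow>
     (\<forall>n. ideal (F n) R) \<and> F 0 = carrier R \<and> (\<forall>n. F (Suc n) \<subseteq> F n) \<and>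
     (\<forall>n. I \<cdot>\<^bsub>R\<^esub> F n \<subseteq> F (Suc n)) \<and>
     (\<exists>n0. \<forall>n\<ge>n0. I \<cdot>\<^bsub>R\<^esub> F n = F (Suc n))"

definition rr_filtration ::
  "('a, 'c) ring_scheme \<Rightarrow> ('a, 'b, 'd) module_scheme \<Rightarrow> 'a set \<Rightarrow> nat \<Rightarrow> 'a set" where
  "rr_filtration R M I n = rr_ideal R M (ideal_pow R I n)"


text \<open>In degree 0 this is the whole ring (\<open>rr_filtration_0\<close>); in degree \<open>n \<ge> 1\<close> it is the
  union of the colon ideals \<open>(I^(n+k) M : I^k M)\<close> over \<open>k \<ge> 1\<close> (\<open>rr_filtration_eq\<close>), which is
  ascending (\<open>colon_step\<close>).\<close>

lemma (in cring) ideal_pow_ideal: "ideal I R \<Longrightarrow> ideal (ideal_pow R I n) R"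
proof -
  assume I: "ideal I R"
  interpret S: comm_monoid "ideals_set R" by (rule ideals_set_is_comm_monoid)
  have "I \<in> carrier (ideals_set R)" using I by (simp add: ideals_set_def)
  then have "ideal_pow R I n \<in> carrier (ideals_set R)" by (rule S.nat_pow_closed)
  then show ?thesis by (simp add: ideals_set_def)
qed

lemma (in cring) ideal_pow_add:
  assumes "ideal I R"
  shows "ideal_pow R I (m + n) = ideal_pow R I m \<cdot> ideal_pow R I n"
proof -
  interpret S: comm_monoid "ideals_set R" by (rule ideals_set_is_comm_monoid)
  have "I \<in> carrier (ideals_set R)" using assms by (simp add: ideals_set_def)
  from S.nat_pow_mult[OF this, of m n] show ?thesis by (simp add: ideals_set_def)
qed

lemma (in cring) ideal_pow_mult:
  assumes "ideal I R"
  shows "ideal_pow R (ideal_pow R I m) n = ideal_pow R I (m * n)"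
proof -
  interpret S: comm_monoid "ideals_set R" by (rule ideals_set_is_comm_monoid)
  have "I \<in> carrier (ideals_set R)" using assms by (simp add: ideals_set_def)
  from S.nat_pow_pow[OF this, of m n] show ?thesis by simp
qed

lemma (in module) gen_submodule_submodule:
  assumes "S \<subseteq> carrier M" shows "submodule (gen_submodule R M S) R M"
proof (rule submoduleI)
  show "gen_submodule R M S \<subseteq> carrier M"
    using assms carrier_is_submodule by (auto simp: gen_submodule_def)
  show "\<zero>\<^bsub>M\<^esub> \<in> gen_submodule R M S"
    by (auto simp: gen_submodule_def dest!: submodule.axioms(1) subgroup.one_closed)
qed (auto simp: gen_submodule_def dest: submoduleE(3-5))

lemma gen_submodule_incl: "S \<subseteq> gen_submodule R M S"
  by (auto simp: gen_submodule_def)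

lemma gen_submodule_min: "submodule N R M \<Longrightarrow> S \<subseteq> N \<Longrightarrow> gen_submodule R M S \<subseteq> N"
  by (auto simp: gen_submodule_def)

lemma (in module) ideal_mod_submodule:
  assumes "ideal L R" shows "submodule (ideal_mod R M L) R M"
  unfolding ideal_mod_def
  by (rule gen_submodule_submodule) (auto simp: ideal.Icarr[OF assms])

lemma ideal_mod_gen: "a \<in> L \<Longrightarrow> x \<in> carrier M \<Longrightarrow> a \<odot>\<^bsub>M\<^esub> x \<in> ideal_mod R M L"
  unfolding ideal_mod_def by (rule subsetD[OF gen_submodule_incl]) auto

lemma (in module) ideal_mod_prod:
  assumes I: "ideal I R" and J: "ideal J R" and a: "a \<in> I" and y: "y \<in> ideal_mod R M J"
  shows "a \<odot>\<^bsub>M\<^esub> y \<in> ideal_mod R M (I \<cdot> J)"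
proof -
  note IJ = ideal_mod_submodule[OF ideal_prod_is_ideal[OF I J]]
  have ac: "a \<in> carrier R" using I a by (rule ideal.Icarr)
  let ?N = "{y \<in> carrier M. a \<odot>\<^bsub>M\<^esub> y \<in> ideal_mod R M (I \<cdot> J)}"
  have "submodule ?N R M"
  proof (rule submoduleI)
    show "\<zero>\<^bsub>M\<^esub> \<in> ?N" using ac subgroup.one_closed[OF submodule.axioms(1)[OF IJ]] by simp
    show "\<And>b. b \<in> ?N \<Longrightarrow> \<ominus>\<^bsub>M\<^esub> b \<in> ?N"
      using ac submoduleE(3)[OF IJ] by (simp add: smult_r_minus)
    show "\<And>b c. b \<in> ?N \<Longrightarrow> c \<in> ?N \<Longrightarrow> b \<oplus>\<^bsub>M\<^esub> c \<in> ?N"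
      using ac submoduleE(5)[OF IJ] by (simp add: smult_r_distr)
    fix c b assume c: "c \<in> carrier R" and b: "b \<in> ?N"
    have "a \<odot>\<^bsub>M\<^esub> (c \<odot>\<^bsub>M\<^esub> b) = c \<odot>\<^bsub>M\<^esub> (a \<odot>\<^bsub>M\<^esub> b)"
      using ac b c by (simp add: smult_assoc1[symmetric] m_comm)
    then show "c \<odot>\<^bsub>M\<^esub> b \<in> ?N" using submoduleE(4)[OF IJ] b c by simp
  qed auto
  moreover have "b \<odot>\<^bsub>M\<^esub> x \<in> ?N" if "b \<in> J" "x \<in> carrier M" for b x
  proof -
    have "b \<in> carrier R" using J that by (blast intro: ideal.Icarr)
    moreover have "(a \<otimes> b) \<odot>\<^bsub>M\<^esub> x \<in> ideal_mod R M (I \<cdot> J)"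
      by (intro ideal_mod_gen ideal_prod.prod a that)
    ultimately show ?thesis using ac that by (simp add: smult_assoc1)
  qed
  ultimately have "ideal_mod R M J \<subseteq> ?N"
    unfolding ideal_mod_def[of R M J] by (intro gen_submodule_min) auto
  then show ?thesis using y by auto
qed

lemma (in module) colon_step:
  assumes I: "ideal I R"
  shows "colon R M (ideal_mod R M (ideal_pow R I (n + k))) (ideal_mod R M (ideal_pow R I k))
    \<subseteq> colon R M (ideal_mod R M (ideal_pow R I (n + (k + j)))) (ideal_mod R M (ideal_pow R I (k + j)))"
    (is "?A \<subseteq> ?B")
proof
  let ?P = "ideal_pow R I"
  note P = ideal_pow_ideal[OF I]
  fix x assume x: "x \<in> ?A"
  then have xc: "x \<in> carrier R" by (simp add: colon_def)
  note T = ideal_mod_submodule[OF P[of "n + (k + j)"]]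
  let ?N = "{y \<in> carrier M. x \<odot>\<^bsub>M\<^esub> y \<in> ideal_mod R M (?P (n + (k + j)))}"
  have N: "submodule ?N R M"
  proof (rule submoduleI)
    show "\<zero>\<^bsub>M\<^esub> \<in> ?N" using xc subgroup.one_closed[OF submodule.axioms(1)[OF T]] by simp
    show "\<And>b. b \<in> ?N \<Longrightarrow> \<ominus>\<^bsub>M\<^esub> b \<in> ?N"
      using xc submoduleE(3)[OF T] by (simp add: smult_r_minus)
    show "\<And>b c. b \<in> ?N \<Longrightarrow> c \<in> ?N \<Longrightarrow> b \<oplus>\<^bsub>M\<^esub> c \<in> ?N"
      using xc submoduleE(5)[OF T] by (simp add: smult_r_distr)
    fix c b assume c: "c \<in> carrier R" and b: "b \<in> ?N"
    have "x \<odot>\<^bsub>M\<^esub> (c \<odot>\<^bsub>M\<^esub> b) = c \<odot>\<^bsub>M\<^esub> (x \<odot>\<^bsub>M\<^esub> b)"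
      using xc b c by (simp add: smult_assoc1[symmetric] m_comm)
    then show "c \<odot>\<^bsub>M\<^esub> b \<in> ?N" using submoduleE(4)[OF T] b c by simp
  qed auto
  have "c \<odot>\<^bsub>M\<^esub> m \<in> ?N" if c: "c \<in> ?P j \<cdot> ?P k" and m: "m \<in> carrier M" for c m
    using c
  proof (induction rule: ideal_prod.induct)
    case (prod a b)
    have ac: "a \<in> carrier R" and bc: "b \<in> carrier R"
      using prod P by (blast intro: ideal.Icarr)+
    have "x \<odot>\<^bsub>M\<^esub> (b \<odot>\<^bsub>M\<^esub> m) \<in> ideal_mod R M (?P (n + k))"
      using x ideal_mod_gen[OF prod(2) m] by (auto simp: colon_def)
    from ideal_mod_prod[OF P P prod(1) this]
    have "a \<odot>\<^bsub>M\<^esub> (x \<odot>\<^bsub>M\<^esub> (b \<odot>\<^bsub>M\<^esub> m)) \<in> ideal_mod R M (?P (n + (k + j)))"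
      by (simp add: ideal_pow_add[OF I, symmetric] add_ac)
    moreover have "a \<odot>\<^bsub>M\<^esub> (x \<odot>\<^bsub>M\<^esub> (b \<odot>\<^bsub>M\<^esub> m)) = x \<odot>\<^bsub>M\<^esub> ((a \<otimes> b) \<odot>\<^bsub>M\<^esub> m)"
      using ac bc xc m by (simp add: smult_assoc1[symmetric] m_ac)
    ultimately show ?case using ac bc m by simp
  next
    case (sum s t)
    have "s \<in> carrier R" "t \<in> carrier R"
      using sum ideal_prod_in_carrier[OF P P] by blast+
    then have "(s \<oplus> t) \<odot>\<^bsub>M\<^esub> m = s \<odot>\<^bsub>M\<^esub> m \<oplus>\<^bsub>M\<^esub> t \<odot>\<^bsub>M\<^esub> m"
      using m by (rule smult_l_distr)
    then show ?case using submoduleE(5)[OF N sum.IH] by simp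
  qed
  then have "ideal_mod R M (?P (k + j)) \<subseteq> ?N"
    unfolding ideal_mod_def[of R M "?P (k + j)"]
    by (intro gen_submodule_min N) (auto simp: ideal_pow_add[OF I, symmetric] add.commute)
  then show "x \<in> ?B" using xc by (auto simp: colon_def)
qed

lemma (in module) rr_filtration_0:
  assumes "ideal I R" shows "rr_filtration R M I 0 = carrier R"
proof -
  have 1: "ideal_pow R (carrier R) k = carrier R" for k
    by (induction k) (simp_all add: ideals_set_def ideal_prod_one[OF oneideal])
  have "ideal_pow R I 0 = carrier R" by (simp add: ideals_set_def)
  then have "rr_filtration R M I 0 =
      (\<Union>k\<in>{1::nat..}. colon R M (ideal_mod R M (carrier R)) (ideal_mod R M (carrier R)))"
    by (simp only: rr_filtration_def rr_ideal_def 1)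
  then show ?thesis
    using submoduleE(4)[OF ideal_mod_submodule[OF oneideal]] by (auto simp: colon_def)
qed

lemma (in module) rr_filtration_eq:
  assumes I: "ideal I R" and n: "n \<ge> 1"
  shows "rr_filtration R M I n =
    (\<Union>k\<in>{1..}. colon R M (ideal_mod R M (ideal_pow R I (n + k))) (ideal_mod R M (ideal_pow R I k)))"
    (is "_ = (\<Union>k\<in>_. ?C k)")
proof -
  have "rr_filtration R M I n = (\<Union>k\<in>{1..}. ?C (n * k))"
    by (simp only: rr_filtration_def rr_ideal_def ideal_pow_mult[OF I] distrib_left mult_1_right
        add.commute)
  also have "\<dots> = (\<Union>k\<in>{1..}. ?C k)"
  proof (intro equalityI UN_least)
    fix k assume "k \<in> {1::nat..}"
    with n show "?C (n * k) \<subseteq> (\<Union>k\<in>{1..}. ?C k)" by (intro UN_upper) auto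
    from n have "n * k = k + (n * k - k)" by simp
    then have "?C k \<subseteq> ?C (n * k)" using colon_step[OF I, of n k "n * k - k"] by simp
    then show "?C k \<subseteq> (\<Union>k\<in>{1..}. ?C (n * k))" using \<open>k \<in> _\<close> by blast
  qed
  finally show ?thesis .
qed

end

theory Submission
  imports Defs
begin

text \<open>
  Write \<open>F n = r(I^n, M)\<close>. That the \<open>F n\<close> are decreasing ideals with \<open>I F n \<subseteq> F (n + 1)\<close> is formal;
  the content is that \<open>F (n + 1) \<subseteq> I F n\<close> for large \<open>n\<close>, in other words that the Rees module
  \<open>\<Oplus> F n\<close> is finitely generated over the Rees algebra \<open>\<Oplus> I^n\<close>. Three ideas give this.

  \<^item> Noetherianity of \<open>\<Oplus> I^n M\<close> (\<open>rees_noetherian_ideal_pow\<close>): submodules \<open>E n \<subseteq> I^n M\<close> with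
    \<open>I E n \<subseteq> E (n + 1)\<close> satisfy \<open>E (n + 1) = I E n\<close> for large \<open>n\<close>. This is the Hilbert basis theorem
    in disguise. Instead of passing to polynomial rings, the generators of \<open>I\<close> are adjoined one at a
    time, and the argument on leading coefficients is carried out inside \<open>M\<close>
    (\<open>rees_noetherian_insert\<close>).

  \<^item> A bound that is uniform in \<open>n\<close> (\<open>rr_filtration_uniform\<close>): each \<open>f \<in> F n\<close> maps \<open>I^k M\<close> into
    \<open>I^(n+k) M\<close> for some \<open>k\<close> that may depend on \<open>f\<close>; one fixed \<open>c\<close> does for all \<open>f\<close> and \<open>n\<close>.
    The reason is that the elements of \<open>\<Oplus> I^n M / I^(n+1) M\<close> killed by a power of \<open>I\<close> (acting as the
    irrelevant ideal) live in finitely many degrees, because by the first idea they form a finitely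
    generated module (\<open>associated_graded_torsion_bounded\<close>).

  \<^item> Evaluation (\<open>eventually_equigenerated_if_separated\<close>): let \<open>x \<in> I\<close> be a nonzerodivisor and
    \<open>m_1, ..., m_s\<close> generators of \<open>M\<close>. If \<open>f x^c m_i = 0\<close> for all \<open>i\<close>, then \<open>f x^c\<close> annihilates \<open>M\<close>,
    hence is zero, hence \<open>f = 0\<close>. So \<open>f \<mapsto> (f x^c m_i)_i\<close> embeds \<open>F n\<close> into \<open>(I^(n+c) M)^s\<close>,
    compatibly with multiplication by \<open>I\<close>, and the first idea applies to the components of
    the image one after the other.
\<close>

section \<open>Submodules, ideals and chains\<close>

lemma (in module) submodule_if_closed:
  assumes "H \<subseteq> carrier M" "\<zero>\<^bsub>M\<^esub> \<in> H"
    and "\<And>x y. x \<in> H \<Longrightarrow> y \<in> H \<Longrightarrow> x \<oplus>\<^bsub>M\<^esub> y \<in> H"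
    and sm: "\<And>a x. a \<in> carrier R \<Longrightarrow> x \<in> H \<Longrightarrow> a \<odot>\<^bsub>M\<^esub> x \<in> H"
  shows "submodule H R M"
proof (rule submoduleI)
  fix x assume x: "x \<in> H"
  then have "x \<in> carrier M" using assms(1) by blast
  then have "\<ominus>\<^bsub>M\<^esub> x = (\<ominus> \<one>) \<odot>\<^bsub>M\<^esub> x" by (simp add: smult_l_minus)
  then show "\<ominus>\<^bsub>M\<^esub> x \<in> H" using sm[of "\<ominus> \<one>" x] x by simp
qed (use assms in auto)

lemma (in cring) ideal_if_closed:
  assumes sub: "J \<subseteq> carrier R" and z: "\<zero> \<in> J"
    and ad: "\<And>x y. x \<in> J \<Longrightarrow> y \<in> J \<Longrightarrow> x \<oplus> y \<in> J"
    and mu: "\<And>a x. a \<in> carrier R \<Longrightarrow> x \<in> J \<Longrightarrow> a \<otimes> x \<in> J"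
  shows "ideal J R"
proof (rule idealI)
  show "ring R" by (rule ring_axioms)
  show "subgroup J (add_monoid R)"
  proof (rule add.subgroupI)
    show "\<ominus> x \<in> J" if "x \<in> J" for x
    proof -
      have "x \<in> carrier R" using sub that by blast
      then have "\<ominus> x = (\<ominus> \<one>) \<otimes> x" by (simp add: l_minus)
      then show ?thesis using mu[of "\<ominus> \<one>" x] that by simp
    qed
  qed (use sub z ad in auto)
  show "x \<otimes> a \<in> J" if "a \<in> J" "x \<in> carrier R" for a x using mu that by blast
  then show "a \<otimes> x \<in> J" if "a \<in> J" "x \<in> carrier R" for a x
    using that sub by (metis m_comm subsetD)
qed

lemma (in module) submodule_zero: "submodule N R M \<Longrightarrow> \<zero>\<^bsub>M\<^esub> \<in> N"
  using subgroup.one_closed[OF submodule.axioms(1)] by fastforce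

lemma (in module) submodule_Icarr: "submodule N R M \<Longrightarrow> x \<in> N \<Longrightarrow> x \<in> carrier M"
  using submoduleE(1) by blast

lemma (in module) zero_submodule: "submodule {\<zero>\<^bsub>M\<^esub>} R M"
  by (rule submodule_if_closed) auto

text \<open>Most membership proofs below approximate an element \<open>x\<close> by some \<open>y\<close> of the submodule and
  then treat the difference, which is simpler than \<open>x\<close>.\<close>

lemma (in module) submodule_mem_if_diff_mem:
  assumes "submodule N R M" "x \<in> carrier M" "y \<in> N" "x \<oplus>\<^bsub>M\<^esub> \<ominus>\<^bsub>M\<^esub> y \<in> N"
  shows "x \<in> N"
proof -
  have "y \<in> carrier M" using assms submodule_Icarr by blast
  then have "x = (x \<oplus>\<^bsub>M\<^esub> \<ominus>\<^bsub>M\<^esub> y) \<oplus>\<^bsub>M\<^esub> y"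
    using assms(2) by (simp add: M.a_assoc M.l_neg)
  then show ?thesis using submoduleE(5)[OF assms(1,4,3)] by simp
qed

lemma (in module) add_diff_add:
  assumes "u \<in> carrier M" "s \<in> carrier M" "t \<in> carrier M"
  shows "(s \<oplus>\<^bsub>M\<^esub> u) \<oplus>\<^bsub>M\<^esub> \<ominus>\<^bsub>M\<^esub> (t \<oplus>\<^bsub>M\<^esub> u) = s \<oplus>\<^bsub>M\<^esub> \<ominus>\<^bsub>M\<^esub> t"
  using assms by (simp add: M.minus_add M.a_ac M.r_neg M.r_neg2)

lemma (in module) submodule_diff:
  assumes "submodule N R M" "x \<in> N" "y \<in> N"
  shows "x \<oplus>\<^bsub>M\<^esub> \<ominus>\<^bsub>M\<^esub> y \<in> N"
  using assms submoduleE(3,5) by blast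

lemma (in module) submodule_vimage_smult:
  assumes N: "submodule N R M" and a: "a \<in> carrier R"
  shows "submodule {y \<in> carrier M. a \<odot>\<^bsub>M\<^esub> y \<in> N} R M"
proof (rule submodule_if_closed)
  show "c \<odot>\<^bsub>M\<^esub> y \<in> {y \<in> carrier M. a \<odot>\<^bsub>M\<^esub> y \<in> N}"
    if "c \<in> carrier R" "y \<in> {y \<in> carrier M. a \<odot>\<^bsub>M\<^esub> y \<in> N}" for c y
  proof -
    have "a \<odot>\<^bsub>M\<^esub> (c \<odot>\<^bsub>M\<^esub> y) = c \<odot>\<^bsub>M\<^esub> (a \<odot>\<^bsub>M\<^esub> y)"
      using a that by (simp add: smult_assoc1[symmetric] m_comm)
    then show ?thesis using that submoduleE(4)[OF N] by simp
  qed
qed (use a submodule_zero[OF N] submoduleE(5)[OF N] in \<open>auto simp: smult_r_distr\<close>)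

lemma (in module) submodule_INT:
  assumes "\<And>a. a \<in> A \<Longrightarrow> submodule (N a) R M"
  shows "submodule {y \<in> carrier M. \<forall>a\<in>A. y \<in> N a} R M"
  by (rule submodule_if_closed) (use assms submodule_zero submoduleE(4,5) in auto)

lemma (in module) submodule_colon:
  assumes "submodule N R M" "A \<subseteq> carrier R"
  shows "submodule {y \<in> carrier M. \<forall>a\<in>A. a \<odot>\<^bsub>M\<^esub> y \<in> N} R M"
proof -
  have "submodule {y \<in> carrier M. \<forall>a\<in>A. y \<in> {y \<in> carrier M. a \<odot>\<^bsub>M\<^esub> y \<in> N}} R M"
    by (rule submodule_INT, rule submodule_vimage_smult) (use assms in auto)
  moreover have "{y \<in> carrier M. \<forall>a\<in>A. y \<in> {y \<in> carrier M. a \<odot>\<^bsub>M\<^esub> y \<in> N}} =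
      {y \<in> carrier M. \<forall>a\<in>A. a \<odot>\<^bsub>M\<^esub> y \<in> N}" by auto
  ultimately show ?thesis by simp
qed

lemma (in module) submodule_Int:
  assumes "submodule N R M" "submodule N' R M"
  shows "submodule (N \<inter> N') R M"
  by (rule submodule_if_closed)
    (use assms submodule_zero submoduleE(4,5) submodule_Icarr in auto)

lemma (in module) submodule_UN_chain:
  fixes N :: "nat \<Rightarrow> 'c set"
  assumes N: "\<And>k. submodule (N k) R M" and step: "\<And>k. N k \<subseteq> N (Suc k)"
  shows "submodule (\<Union>k. N k) R M"
proof (rule submodule_if_closed)
  have mono: "N i \<subseteq> N j" if "i \<le> j" for i j using step that by (rule lift_Suc_mono_le)
  show "x \<oplus>\<^bsub>M\<^esub> y \<in> (\<Union>k. N k)" if "x \<in> (\<Union>k. N k)" "y \<in> (\<Union>k. N k)" for x y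
  proof -
    from that obtain i j where "x \<in> N i" "y \<in> N j" by blast
    then have "x \<in> N (max i j)" "y \<in> N (max i j)"
      using mono[of i "max i j"] mono[of j "max i j"] by auto
    then show ?thesis using submoduleE(5)[OF N] by blast
  qed
qed (use N submodule_zero submoduleE(4) submodule_Icarr in blast)+

lemma (in module) smult_ideal:
  assumes N: "submodule N R M" and y: "y \<in> carrier M"
  shows "ideal {a \<in> carrier R. a \<odot>\<^bsub>M\<^esub> y \<in> N} R"
  by (rule ideal_if_closed)
    (use y submodule_zero[OF N] submoduleE(4,5)[OF N] in
      \<open>auto simp: smult_l_distr smult_assoc1\<close>)

lemma (in cring) ideal_prod_subset:
  assumes "ideal K R" "\<And>b c. b \<in> I \<Longrightarrow> c \<in> J \<Longrightarrow> b \<otimes> c \<in> K"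
  shows "I \<cdot> J \<subseteq> K"
proof
  fix x assume "x \<in> I \<cdot> J"
  then show "x \<in> K"
    by induction (use assms in \<open>auto intro: additive_subgroup.a_closed[OF ideal.axioms(1)]\<close>)
qed

text \<open>Chains, and not generators, because the arguments below need a single exponent or index that
  works for all elements of some submodule, which is given as an increasing union.\<close>

definition noetherian_module :: "('a, 'c) ring_scheme \<Rightarrow> ('a, 'b, 'd) module_scheme \<Rightarrow> bool" where
  "noetherian_module R M \<longleftrightarrow>
     (\<forall>N :: nat \<Rightarrow> 'b set. (\<forall>k. submodule (N k) R M) \<and> (\<forall>k. N k \<subseteq> N (Suc k))
        \<longrightarrow> (\<exists>k. \<forall>j\<ge>k. N j = N k))"

lemma noetherian_moduleD:
  assumes "noetherian_module R M" "\<And>k. submodule (N k) R M" "\<And>k::nat. N k \<subseteq> N (Suc k)"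
  shows "\<exists>k. \<forall>j\<ge>k. N j = N k"
  using assms unfolding noetherian_module_def by blast

lemma (in noetherian_ring) ideal_chain_stabilises:
  fixes C :: "nat \<Rightarrow> 'a set"
  assumes C: "\<And>k. ideal (C k) R" and step: "\<And>k. C k \<subseteq> C (Suc k)"
  shows "\<exists>k. \<forall>j\<ge>k. C j = C k"
proof -
  have mono: "C i \<subseteq> C j" if "i \<le> j" for i j using step that by (rule lift_Suc_mono_le)
  then have "C i \<subseteq> C j \<or> C j \<subseteq> C i" for i j by (meson nle_le)
  then have "subset.chain {I. ideal I R} (range C)" unfolding subset_chain_def using C by auto
  then have "\<Union>(range C) \<in> range C" by (intro ideal_chain_is_trivial) auto
  then obtain k where "\<Union>(range C) = C k" by blast
  then show ?thesis using mono by blast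
qed

lemma (in module) gen_submodule_insert_subset:
  assumes "S \<subseteq> carrier M" "s \<in> carrier M"
  shows "gen_submodule R M (insert s S) \<subseteq>
    {t \<oplus>\<^bsub>M\<^esub> a \<odot>\<^bsub>M\<^esub> s | t a. t \<in> gen_submodule R M S \<and> a \<in> carrier R}" (is "_ \<subseteq> ?T")
proof (rule gen_submodule_min)
  note G = gen_submodule_submodule[OF assms(1)]
  have GI: "t \<in> carrier M" if "t \<in> gen_submodule R M S" for t using submodule_Icarr[OF G that] .
  show "submodule ?T R M"
  proof (rule submodule_if_closed)
    show "\<zero>\<^bsub>M\<^esub> \<in> ?T"
      using submodule_zero[OF G] assms(2)
      by (intro CollectI exI[of _ "\<zero>\<^bsub>M\<^esub>"] exI[of _ "\<zero>"]) simp
    show "x \<oplus>\<^bsub>M\<^esub> y \<in> ?T" if xy: "x \<in> ?T" "y \<in> ?T" for x y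
    proof -
      from xy obtain t a u b where h: "t \<in> gen_submodule R M S" "a \<in> carrier R" "x = t \<oplus>\<^bsub>M\<^esub> a \<odot>\<^bsub>M\<^esub> s"
        "u \<in> gen_submodule R M S" "b \<in> carrier R" "y = u \<oplus>\<^bsub>M\<^esub> b \<odot>\<^bsub>M\<^esub> s" by blast
      then have "x \<oplus>\<^bsub>M\<^esub> y = (t \<oplus>\<^bsub>M\<^esub> u) \<oplus>\<^bsub>M\<^esub> (a \<oplus> b) \<odot>\<^bsub>M\<^esub> s"
        using assms(2) GI by (simp add: smult_l_distr M.a_ac)
      then show ?thesis using h submoduleE(5)[OF G] by blast
    qed
    show "c \<odot>\<^bsub>M\<^esub> x \<in> ?T" if c: "c \<in> carrier R" and x: "x \<in> ?T" for c x
    proof -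
      from x obtain t a where h: "t \<in> gen_submodule R M S" "a \<in> carrier R" "x = t \<oplus>\<^bsub>M\<^esub> a \<odot>\<^bsub>M\<^esub> s"
        by blast
      then have "c \<odot>\<^bsub>M\<^esub> x = c \<odot>\<^bsub>M\<^esub> t \<oplus>\<^bsub>M\<^esub> (c \<otimes> a) \<odot>\<^bsub>M\<^esub> s"
        using assms(2) GI c by (simp add: smult_r_distr smult_assoc1)
      then show ?thesis using h c submoduleE(4)[OF G] by blast
    qed
  qed (use GI assms(2) in auto)
  show "insert s S \<subseteq> ?T"
  proof
    fix x assume "x \<in> insert s S"
    then consider "x = s" | "x \<in> S" by blast
    then show "x \<in> ?T"
    proof cases
      case 1
      then show ?thesis using submodule_zero[OF G] assms(2)
        by (intro CollectI exI[of _ "\<zero>\<^bsub>M\<^esub>"] exI[of _ "\<one>"]) simp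
    next
      case 2
      then show ?thesis using gen_submodule_incl[of S R M] assms
        by (intro CollectI exI[of _ x] exI[of _ "\<zero>"]) auto
    qed
  qed
qed

text \<open>A chain of submodules of \<open>M\<close> is controlled, one generator \<open>s\<close> at a time, by its traces on the
  submodules generated by fewer elements and by the chain of ideals of coefficients with which
  \<open>s\<close> occurs.\<close>

lemma (in module) noetherian_module_if_fg:
  assumes noeth: "noetherian_ring R" and fg: "fg_module R M"
  shows "noetherian_module R M"
  unfolding noetherian_module_def
proof (intro allI impI)
  fix N :: "nat \<Rightarrow> 'c set"
  assume "(\<forall>k. submodule (N k) R M) \<and> (\<forall>k. N k \<subseteq> N (Suc k))"
  then have N: "\<And>k. submodule (N k) R M" and step: "\<And>k. N k \<subseteq> N (Suc k)" by auto
  have mono: "N i \<subseteq> N j" if "i \<le> j" for i j using step that by (rule lift_Suc_mono_le)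
  have trace: "\<exists>k. \<forall>j\<ge>k. N j \<inter> gen_submodule R M S \<subseteq> N k" if "finite S" "S \<subseteq> carrier M" for S
    using that
  proof (induction S)
    case empty
    have "gen_submodule R M {} \<subseteq> {\<zero>\<^bsub>M\<^esub>}" by (rule gen_submodule_min) (auto simp: zero_submodule)
    then show ?case using submodule_zero[OF N] by blast
  next
    case (insert s S)
    let ?G = "gen_submodule R M S"
    have s: "s \<in> carrier M" and S: "S \<subseteq> carrier M" using insert.prems by auto
    note G = gen_submodule_submodule[OF S]
    obtain k1 where k1: "\<And>j. j \<ge> k1 \<Longrightarrow> N j \<inter> ?G \<subseteq> N k1" using insert S by blast
    let ?C = "\<lambda>k. {a \<in> carrier R. \<exists>t\<in>?G. t \<oplus>\<^bsub>M\<^esub> a \<odot>\<^bsub>M\<^esub> s \<in> N k}"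
    have C: "ideal (?C k) R" for k
    proof (rule ideal_if_closed)
      show "\<zero> \<in> ?C k"
        using submodule_zero[OF G] submodule_zero[OF N] s by (auto intro!: bexI[of _ "\<zero>\<^bsub>M\<^esub>"])
      show "a \<oplus> b \<in> ?C k" if ab: "a \<in> ?C k" "b \<in> ?C k" for a b
      proof -
        from ab obtain t u where h: "a \<in> carrier R" "b \<in> carrier R" "t \<in> ?G" "u \<in> ?G"
          "t \<oplus>\<^bsub>M\<^esub> a \<odot>\<^bsub>M\<^esub> s \<in> N k" "u \<oplus>\<^bsub>M\<^esub> b \<odot>\<^bsub>M\<^esub> s \<in> N k" by blast
        have "(t \<oplus>\<^bsub>M\<^esub> a \<odot>\<^bsub>M\<^esub> s) \<oplus>\<^bsub>M\<^esub> (u \<oplus>\<^bsub>M\<^esub> b \<odot>\<^bsub>M\<^esub> s) = (t \<oplus>\<^bsub>M\<^esub> u) \<oplus>\<^bsub>M\<^esub> (a \<oplus> b) \<odot>\<^bsub>M\<^esub> s"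
          using h s submodule_Icarr[OF G] by (simp add: smult_l_distr M.a_ac)
        then have "(t \<oplus>\<^bsub>M\<^esub> u) \<oplus>\<^bsub>M\<^esub> (a \<oplus> b) \<odot>\<^bsub>M\<^esub> s \<in> N k" using submoduleE(5)[OF N h(5,6)] by simp
        then show ?thesis using h submoduleE(5)[OF G h(3,4)] by blast
      qed
      show "c \<otimes> a \<in> ?C k" if ca: "c \<in> carrier R" "a \<in> ?C k" for c a
      proof -
        from ca obtain t where h: "a \<in> carrier R" "t \<in> ?G" "t \<oplus>\<^bsub>M\<^esub> a \<odot>\<^bsub>M\<^esub> s \<in> N k" by blast
        have "c \<odot>\<^bsub>M\<^esub> (t \<oplus>\<^bsub>M\<^esub> a \<odot>\<^bsub>M\<^esub> s) = c \<odot>\<^bsub>M\<^esub> t \<oplus>\<^bsub>M\<^esub> (c \<otimes> a) \<odot>\<^bsub>M\<^esub> s"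
          using h s ca submodule_Icarr[OF G] by (simp add: smult_r_distr smult_assoc1)
        then have "c \<odot>\<^bsub>M\<^esub> t \<oplus>\<^bsub>M\<^esub> (c \<otimes> a) \<odot>\<^bsub>M\<^esub> s \<in> N k" using submoduleE(4)[OF N ca(1) h(3)] by simp
        then show ?thesis using h ca submoduleE(4)[OF G ca(1) h(2)] by blast
      qed
    qed auto
    obtain k2 where k2: "\<And>j. j \<ge> k2 \<Longrightarrow> ?C j = ?C k2"
      using noetherian_ring.ideal_chain_stabilises[OF noeth, of ?C] C step by blast
    define k where "k = max k1 k2"
    have "N j \<inter> gen_submodule R M (insert s S) \<subseteq> N k" if j: "j \<ge> k" for j
    proof
      fix x assume x: "x \<in> N j \<inter> gen_submodule R M (insert s S)"
      then obtain t a where ta: "t \<in> ?G" "a \<in> carrier R" "x = t \<oplus>\<^bsub>M\<^esub> a \<odot>\<^bsub>M\<^esub> s"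
        using gen_submodule_insert_subset[OF S s] by blast
      then have "a \<in> ?C j" using x by blast
      then have "a \<in> ?C k" using k2[of j] k2[of k] j unfolding k_def by simp
      then obtain u where u: "u \<in> ?G" "u \<oplus>\<^bsub>M\<^esub> a \<odot>\<^bsub>M\<^esub> s \<in> N k" by blast
      let ?y = "u \<oplus>\<^bsub>M\<^esub> a \<odot>\<^bsub>M\<^esub> s"
      have "x \<oplus>\<^bsub>M\<^esub> \<ominus>\<^bsub>M\<^esub> ?y = t \<oplus>\<^bsub>M\<^esub> \<ominus>\<^bsub>M\<^esub> u"
        unfolding ta(3) by (rule add_diff_add) (use ta u s submodule_Icarr[OF G] in auto)
      moreover have "x \<oplus>\<^bsub>M\<^esub> \<ominus>\<^bsub>M\<^esub> ?y \<in> N j"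
        using submodule_diff[OF N] x u(2) mono[OF j] by blast
      moreover have "t \<oplus>\<^bsub>M\<^esub> \<ominus>\<^bsub>M\<^esub> u \<in> ?G" using submodule_diff[OF G ta(1) u(1)] .
      ultimately have "x \<oplus>\<^bsub>M\<^esub> \<ominus>\<^bsub>M\<^esub> ?y \<in> N k1" using k1[of j] j by (simp add: k_def subset_iff)
      then have "x \<oplus>\<^bsub>M\<^esub> \<ominus>\<^bsub>M\<^esub> ?y \<in> N k" using mono[of k1 k] by (auto simp: k_def)
      then show "x \<in> N k"
        using submodule_mem_if_diff_mem[OF N _ u(2)] x submodule_Icarr[OF N] by blast
    qed
    then show ?case by blast
  qed
  obtain S where "finite S" "S \<subseteq> carrier M" "carrier M = gen_submodule R M S"
    using fg unfolding fg_module_def by blast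
  then obtain k where "\<forall>j\<ge>k. N j \<inter> carrier M \<subseteq> N k" using trace by metis
  then show "\<exists>k. \<forall>j\<ge>k. N j = N k" using mono submoduleE(1)[OF N] by blast
qed

section \<open>Equigenerated systems of submodules\<close>

definition smult_span ::
  "('a, 'c) ring_scheme \<Rightarrow> ('a, 'b, 'd) module_scheme \<Rightarrow> 'a set \<Rightarrow> 'b set \<Rightarrow> 'b set" where
  "smult_span R M A E = gen_submodule R M {a \<odot>\<^bsub>M\<^esub> x | a x. a \<in> A \<and> x \<in> E}"

lemma (in module) smult_span_submodule:
  assumes "A \<subseteq> carrier R" "E \<subseteq> carrier M"
  shows "submodule (smult_span R M A E) R M"
  unfolding smult_span_def by (rule gen_submodule_submodule) (use assms in auto)

lemma smult_span_gen: "a \<in> A \<Longrightarrow> x \<in> E \<Longrightarrow> a \<odot>\<^bsub>M\<^esub> x \<in> smult_span R M A E"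
  unfolding smult_span_def by (rule subsetD[OF gen_submodule_incl]) auto

lemma smult_span_min:
  "submodule N R M \<Longrightarrow> (\<And>a x. a \<in> A \<Longrightarrow> x \<in> E \<Longrightarrow> a \<odot>\<^bsub>M\<^esub> x \<in> N) \<Longrightarrow> smult_span R M A E \<subseteq> N"
  unfolding smult_span_def by (rule gen_submodule_min) auto

lemma (in module) smult_span_mono:
  assumes "B \<subseteq> carrier R" "F \<subseteq> carrier M" "A \<subseteq> B" "E \<subseteq> F"
  shows "smult_span R M A E \<subseteq> smult_span R M B F"
  by (rule smult_span_min[OF smult_span_submodule[OF assms(1,2)]])
    (use assms in \<open>auto intro: smult_span_gen\<close>)

text \<open>A compatible system is a graded submodule of the Rees module, given by its homogeneous
  components. It is enough to test multiplication by a set \<open>A\<close> of generators of the ideal.\<close>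

definition compatible_system ::
  "('a, 'c) ring_scheme \<Rightarrow> ('a, 'b, 'd) module_scheme \<Rightarrow> 'a set \<Rightarrow> (nat \<Rightarrow> 'b set) \<Rightarrow> bool" where
  "compatible_system R M A E \<longleftrightarrow>
     (\<forall>n. submodule (E n) R M) \<and> (\<forall>n. \<forall>a\<in>A. \<forall>x\<in>E n. a \<odot>\<^bsub>M\<^esub> x \<in> E (Suc n))"

text \<open>Noetherianity of the graded module \<open>\<Oplus> P n\<close> over the Rees algebra of the ideal generated by
  \<open>A\<close>: each graded submodule is generated in bounded degree. Finite generation of the single
  components is a matter of the ambient module.\<close>

definition rees_noetherian ::
  "('a, 'c) ring_scheme \<Rightarrow> ('a, 'b, 'd) module_scheme \<Rightarrow> 'a set \<Rightarrow> (nat \<Rightarrow> 'b set) \<Rightarrow> bool" where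
  "rees_noetherian R M A P \<longleftrightarrow>
     (\<forall>E. compatible_system R M A E \<and> (\<forall>n. E n \<subseteq> P n)
        \<longrightarrow> (\<exists>n0. \<forall>n\<ge>n0. E (Suc n) \<subseteq> smult_span R M A (E n)))"

lemma compatible_systemD:
  assumes "compatible_system R M A E"
  shows "submodule (E n) R M" "a \<in> A \<Longrightarrow> x \<in> E n \<Longrightarrow> a \<odot>\<^bsub>M\<^esub> x \<in> E (Suc n)"
  using assms unfolding compatible_system_def by auto

lemma rees_noetherianD:
  assumes "rees_noetherian R M A P" "compatible_system R M A E" "\<And>n. E n \<subseteq> P n"
  obtains n0 where "\<And>n. n \<ge> n0 \<Longrightarrow> E (Suc n) \<subseteq> smult_span R M A (E n)"
  using assms unfolding rees_noetherian_def by blast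

text \<open>\<open>layers R M a P j n\<close> is \<open>P n + a P (n - 1) + ... + a^(j - 1) P (n - j + 1)\<close>. For \<open>j = n + 1\<close> it is the
  degree \<open>n\<close> part of the module obtained from \<open>\<Oplus> P n\<close> by adjoining \<open>a\<close> in degree one. It is used
  for \<open>j \<le> n + 1\<close>, where the difference in the recursion is never truncated.\<close>

primrec layers ::
  "('a, 'c) ring_scheme \<Rightarrow> ('a, 'b, 'd) module_scheme \<Rightarrow> 'a \<Rightarrow> (nat \<Rightarrow> 'b set) \<Rightarrow> nat \<Rightarrow> nat \<Rightarrow> 'b set"
where
  "layers R M a P 0 n = {\<zero>\<^bsub>M\<^esub>}"
| "layers R M a P (Suc j) n =
     {(a [^]\<^bsub>R\<^esub> j) \<odot>\<^bsub>M\<^esub> y \<oplus>\<^bsub>M\<^esub> w | y w. y \<in> P (n - j) \<and> w \<in> layers R M a P j n}"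

text \<open>With \<open>a\<close> in the role of a polynomial variable, this is the module of leading coefficients
  \<open>y \<in> P i\<close> of the elements \<open>a^j y + (terms of lower degree in a)\<close> of \<open>E (i + j)\<close>. Since \<open>a\<close> is an
  element of the ring and no variable, an element of \<open>E\<close> may have several such expressions; all of
  them are admitted.\<close>

definition leading ::
  "('a, 'c) ring_scheme \<Rightarrow> ('a, 'b, 'd) module_scheme \<Rightarrow> 'a \<Rightarrow> (nat \<Rightarrow> 'b set) \<Rightarrow> (nat \<Rightarrow> 'b set)
     \<Rightarrow> nat \<Rightarrow> nat \<Rightarrow> 'b set" where
  "leading R M a P E j i =
     {y \<in> P i. \<exists>w\<in>layers R M a P j (i + j). (a [^]\<^bsub>R\<^esub> j) \<odot>\<^bsub>M\<^esub> y \<oplus>\<^bsub>M\<^esub> w \<in> E (i + j)}"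

context module
begin

lemma smult_pow_Suc:
  assumes "a \<in> carrier R" "y \<in> carrier M"
  shows "a \<odot>\<^bsub>M\<^esub> ((a [^] j) \<odot>\<^bsub>M\<^esub> y) = (a [^] Suc j) \<odot>\<^bsub>M\<^esub> y"
  using assms by (simp add: smult_assoc1[symmetric] m_comm)

lemma smult_lin_comm:
  assumes "a \<in> carrier R" "c \<in> carrier R" "y \<in> carrier M" "w \<in> carrier M"
  shows "c \<odot>\<^bsub>M\<^esub> (a \<odot>\<^bsub>M\<^esub> y \<oplus>\<^bsub>M\<^esub> w) = a \<odot>\<^bsub>M\<^esub> (c \<odot>\<^bsub>M\<^esub> y) \<oplus>\<^bsub>M\<^esub> c \<odot>\<^bsub>M\<^esub> w"
  using assms by (simp add: smult_r_distr smult_assoc1[symmetric] m_comm)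

lemma add_lin:
  assumes "a \<in> carrier R" "y \<in> carrier M" "w \<in> carrier M" "y' \<in> carrier M" "w' \<in> carrier M"
  shows "(a \<odot>\<^bsub>M\<^esub> y \<oplus>\<^bsub>M\<^esub> w) \<oplus>\<^bsub>M\<^esub> (a \<odot>\<^bsub>M\<^esub> y' \<oplus>\<^bsub>M\<^esub> w') = a \<odot>\<^bsub>M\<^esub> (y \<oplus>\<^bsub>M\<^esub> y') \<oplus>\<^bsub>M\<^esub> (w \<oplus>\<^bsub>M\<^esub> w')"
  using assms by (simp add: smult_r_distr M.a_ac)

lemma layers_submodule:
  assumes a: "a \<in> carrier R" and P: "\<And>n. submodule (P n) R M"
  shows "submodule (layers R M a P j n) R M"
proof (induction j)
  case 0
  show ?case by (simp add: zero_submodule)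
next
  case (Suc j)
  note IH = Suc.IH
  have ap: "a [^] j \<in> carrier R" using a by simp
  show ?case
  proof (rule submodule_if_closed)
    show "layers R M a P (Suc j) n \<subseteq> carrier M"
      using ap submodule_Icarr[OF P] submodule_Icarr[OF IH] by auto
    have "\<zero>\<^bsub>M\<^esub> = (a [^] j) \<odot>\<^bsub>M\<^esub> \<zero>\<^bsub>M\<^esub> \<oplus>\<^bsub>M\<^esub> \<zero>\<^bsub>M\<^esub>" using ap by simp
    then show "\<zero>\<^bsub>M\<^esub> \<in> layers R M a P (Suc j) n"
      using submodule_zero[OF P] submodule_zero[OF IH] by fastforce
    show "u \<oplus>\<^bsub>M\<^esub> v \<in> layers R M a P (Suc j) n"
      if uv: "u \<in> layers R M a P (Suc j) n" "v \<in> layers R M a P (Suc j) n" for u v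
    proof -
      from uv obtain y w y' w' where h: "y \<in> P (n - j)" "w \<in> layers R M a P j n"
        "u = (a [^] j) \<odot>\<^bsub>M\<^esub> y \<oplus>\<^bsub>M\<^esub> w" "y' \<in> P (n - j)" "w' \<in> layers R M a P j n"
        "v = (a [^] j) \<odot>\<^bsub>M\<^esub> y' \<oplus>\<^bsub>M\<^esub> w'" by auto
      then have "u \<oplus>\<^bsub>M\<^esub> v = (a [^] j) \<odot>\<^bsub>M\<^esub> (y \<oplus>\<^bsub>M\<^esub> y') \<oplus>\<^bsub>M\<^esub> (w \<oplus>\<^bsub>M\<^esub> w')"
        using ap submodule_Icarr[OF P] submodule_Icarr[OF IH] by (simp add: add_lin)
      then show ?thesis using submoduleE(5)[OF P h(1,4)] submoduleE(5)[OF IH h(2,5)] by auto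
    qed
    show "c \<odot>\<^bsub>M\<^esub> u \<in> layers R M a P (Suc j) n"
      if c: "c \<in> carrier R" and u: "u \<in> layers R M a P (Suc j) n" for c u
    proof -
      from u obtain y w where h: "y \<in> P (n - j)" "w \<in> layers R M a P j n"
        "u = (a [^] j) \<odot>\<^bsub>M\<^esub> y \<oplus>\<^bsub>M\<^esub> w" by auto
      then have "c \<odot>\<^bsub>M\<^esub> u = (a [^] j) \<odot>\<^bsub>M\<^esub> (c \<odot>\<^bsub>M\<^esub> y) \<oplus>\<^bsub>M\<^esub> c \<odot>\<^bsub>M\<^esub> w"
        using ap c submodule_Icarr[OF P] submodule_Icarr[OF IH] by (simp add: smult_lin_comm)
      then show ?thesis using submoduleE(4)[OF P c h(1)] submoduleE(4)[OF IH c h(2)] by auto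
    qed
  qed
qed

lemma layers_subset_Suc:
  assumes a: "a \<in> carrier R" and P: "\<And>n. submodule (P n) R M"
  shows "layers R M a P j n \<subseteq> layers R M a P (Suc j) n"
proof
  fix w assume w: "w \<in> layers R M a P j n"
  then have "w = (a [^] j) \<odot>\<^bsub>M\<^esub> \<zero>\<^bsub>M\<^esub> \<oplus>\<^bsub>M\<^esub> w"
    using a submodule_Icarr[OF layers_submodule[OF a P]] by simp
  then show "w \<in> layers R M a P (Suc j) n" using w submodule_zero[OF P] by auto
qed

lemma smult_layers_Suc:
  assumes a: "a \<in> carrier R" and P: "\<And>n. submodule (P n) R M"
  shows "w \<in> layers R M a P j n \<Longrightarrow> a \<odot>\<^bsub>M\<^esub> w \<in> layers R M a P (Suc j) (Suc n)"
proof (induction j arbitrary: w)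
  case 0
  have "\<zero>\<^bsub>M\<^esub> \<in> layers R M a P (Suc 0) (Suc n)"
    by (rule submodule_zero[OF layers_submodule[OF a P]])
  then show ?case using 0 a by (simp del: layers.simps(2))
next
  case (Suc j)
  from Suc.prems obtain y v where h: "y \<in> P (n - j)" "v \<in> layers R M a P j n"
    "w = (a [^] j) \<odot>\<^bsub>M\<^esub> y \<oplus>\<^bsub>M\<^esub> v" by auto
  then have "a \<odot>\<^bsub>M\<^esub> w = (a [^] Suc j) \<odot>\<^bsub>M\<^esub> y \<oplus>\<^bsub>M\<^esub> a \<odot>\<^bsub>M\<^esub> v"
    using a submodule_Icarr[OF P] submodule_Icarr[OF layers_submodule[OF a P]]
    by (simp add: smult_r_distr smult_pow_Suc del: nat_pow_Suc)
  moreover have "y \<in> P (Suc n - Suc j)" using h(1) by simp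
  ultimately show ?case
    unfolding layers.simps(2)[of R M a P "Suc j"] using Suc.IH[OF h(2)] by blast
qed

lemma smult_layers:
  assumes a: "a \<in> carrier R" and P: "compatible_system R M A P" and b: "b \<in> A" "b \<in> carrier R"
  shows "j \<le> Suc n \<Longrightarrow> w \<in> layers R M a P j n \<Longrightarrow> b \<odot>\<^bsub>M\<^esub> w \<in> layers R M a P j (Suc n)"
proof (induction j arbitrary: w)
  case 0
  then show ?case using b by simp
next
  case (Suc j)
  note Ps = compatible_systemD(1)[OF P]
  from Suc.prems obtain y v where h: "y \<in> P (n - j)" "v \<in> layers R M a P j n"
    "w = (a [^] j) \<odot>\<^bsub>M\<^esub> y \<oplus>\<^bsub>M\<^esub> v" by auto
  then have "b \<odot>\<^bsub>M\<^esub> w = (a [^] j) \<odot>\<^bsub>M\<^esub> (b \<odot>\<^bsub>M\<^esub> y) \<oplus>\<^bsub>M\<^esub> b \<odot>\<^bsub>M\<^esub> v"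
    using a b submodule_Icarr[OF Ps] submodule_Icarr[OF layers_submodule[OF a Ps]]
    by (simp add: smult_lin_comm)
  moreover have "b \<odot>\<^bsub>M\<^esub> y \<in> P (Suc n - j)"
    using compatible_systemD(2)[OF P b(1) h(1)] Suc.prems(1) by (simp add: Suc_diff_le)
  ultimately show ?case using Suc.IH[OF _ h(2)] Suc.prems(1) by auto
qed

lemma leading_compatible:
  assumes a: "a \<in> carrier R" and A: "A \<subseteq> carrier R"
    and P: "compatible_system R M A P" and E: "compatible_system R M A E"
  shows "compatible_system R M A (leading R M a P E j)"
proof -
  let ?L = "leading R M a P E j"
  note Ps = compatible_systemD(1)[OF P] and Es = compatible_systemD(1)[OF E]
  have Ws: "submodule (layers R M a P k n) R M" for k n by (rule layers_submodule[OF a Ps])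
  note Ic = submodule_Icarr[OF Ps] submodule_Icarr[OF Ws]
  have ap: "a [^] j \<in> carrier R" using a by simp
  have "submodule (?L i) R M" for i
  proof (rule submodule_if_closed)
    show "?L i \<subseteq> carrier M" using Ic by (auto simp: leading_def)
    have "(a [^] j) \<odot>\<^bsub>M\<^esub> \<zero>\<^bsub>M\<^esub> \<oplus>\<^bsub>M\<^esub> \<zero>\<^bsub>M\<^esub> \<in> E (i + j)" using ap submodule_zero[OF Es] by simp
    then show "\<zero>\<^bsub>M\<^esub> \<in> ?L i"
      unfolding leading_def using submodule_zero[OF Ps] submodule_zero[OF Ws] by blast
    show "y \<oplus>\<^bsub>M\<^esub> y' \<in> ?L i" if yy: "y \<in> ?L i" "y' \<in> ?L i" for y y'
    proof -
      let ?W = "layers R M a P j (i + j)"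
      from yy obtain w w' where h: "y \<in> P i" "y' \<in> P i" "w \<in> ?W" "w' \<in> ?W"
        "(a [^] j) \<odot>\<^bsub>M\<^esub> y \<oplus>\<^bsub>M\<^esub> w \<in> E (i + j)" "(a [^] j) \<odot>\<^bsub>M\<^esub> y' \<oplus>\<^bsub>M\<^esub> w' \<in> E (i + j)"
        unfolding leading_def by blast
      have "(a [^] j) \<odot>\<^bsub>M\<^esub> (y \<oplus>\<^bsub>M\<^esub> y') \<oplus>\<^bsub>M\<^esub> (w \<oplus>\<^bsub>M\<^esub> w') \<in> E (i + j)"
        using submoduleE(5)[OF Es h(5,6)] h ap Ic by (simp add: add_lin)
      then show ?thesis
        unfolding leading_def using submoduleE(5)[OF Ps h(1,2)] submoduleE(5)[OF Ws h(3,4)] by blast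
    qed
    show "c \<odot>\<^bsub>M\<^esub> y \<in> ?L i" if c: "c \<in> carrier R" and y: "y \<in> ?L i" for c y
    proof -
      from y obtain w where h: "y \<in> P i" "w \<in> layers R M a P j (i + j)"
        "(a [^] j) \<odot>\<^bsub>M\<^esub> y \<oplus>\<^bsub>M\<^esub> w \<in> E (i + j)" unfolding leading_def by blast
      have "(a [^] j) \<odot>\<^bsub>M\<^esub> (c \<odot>\<^bsub>M\<^esub> y) \<oplus>\<^bsub>M\<^esub> c \<odot>\<^bsub>M\<^esub> w \<in> E (i + j)"
        using submoduleE(4)[OF Es c h(3)] h ap Ic c by (simp add: smult_lin_comm)
      then show ?thesis
        unfolding leading_def using submoduleE(4)[OF Ps c h(1)] submoduleE(4)[OF Ws c h(2)] by blast
    qed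
  qed
  moreover have "b \<odot>\<^bsub>M\<^esub> y \<in> ?L (Suc i)" if b: "b \<in> A" and y: "y \<in> ?L i" for b y i
  proof -
    have bc: "b \<in> carrier R" using A b by blast
    from y obtain w where h: "y \<in> P i" "w \<in> layers R M a P j (i + j)"
      "(a [^] j) \<odot>\<^bsub>M\<^esub> y \<oplus>\<^bsub>M\<^esub> w \<in> E (i + j)" unfolding leading_def by blast
    have "(a [^] j) \<odot>\<^bsub>M\<^esub> (b \<odot>\<^bsub>M\<^esub> y) \<oplus>\<^bsub>M\<^esub> b \<odot>\<^bsub>M\<^esub> w \<in> E (Suc i + j)"
      using compatible_systemD(2)[OF E b h(3)] h ap Ic bc by (simp add: smult_lin_comm)
    moreover have "b \<odot>\<^bsub>M\<^esub> w \<in> layers R M a P j (Suc i + j)"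
      using smult_layers[OF a P b bc _ h(2)] by simp
    ultimately show ?thesis
      unfolding leading_def using compatible_systemD(2)[OF P b h(1)] by blast
  qed
  ultimately show ?thesis unfolding compatible_system_def by blast
qed

lemma leading_subset_Suc:
  assumes a: "a \<in> carrier R"
    and P: "compatible_system R M A P" and E: "compatible_system R M (insert a B) E"
  shows "leading R M a P E j i \<subseteq> leading R M a P E (Suc j) i"
proof
  note Ps = compatible_systemD(1)[OF P]
  note Ic = submodule_Icarr[OF Ps] submodule_Icarr[OF layers_submodule[OF a Ps]]
  fix y assume "y \<in> leading R M a P E j i"
  then obtain w where h: "y \<in> P i" "w \<in> layers R M a P j (i + j)"
    "(a [^] j) \<odot>\<^bsub>M\<^esub> y \<oplus>\<^bsub>M\<^esub> w \<in> E (i + j)" unfolding leading_def by blast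
  have "(a [^] Suc j) \<odot>\<^bsub>M\<^esub> y \<oplus>\<^bsub>M\<^esub> a \<odot>\<^bsub>M\<^esub> w \<in> E (i + Suc j)"
    using compatible_systemD(2)[OF E _ h(3), of a] h a Ic
    by (simp add: smult_r_distr smult_pow_Suc del: nat_pow_Suc)
  moreover have "a \<odot>\<^bsub>M\<^esub> w \<in> layers R M a P (Suc j) (i + Suc j)"
    using smult_layers_Suc[OF a Ps h(2)] by simp
  ultimately show "y \<in> leading R M a P E (Suc j) i" unfolding leading_def using h(1) by blast
qed

text \<open>For each single \<open>i\<close> the chain of leading coefficients in \<open>P i\<close> stabilises, but the bound must
  not depend on \<open>i\<close>. The unions over \<open>j\<close> form a compatible system, which is generated in degrees up to
  some \<open>i0\<close>; once the chain is stationary in these finitely many degrees, it has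
  reached the generators of the union and is therefore stationary in all degrees.\<close>

lemma leading_stabilises:
  assumes nM: "noetherian_module R M" and a: "a \<in> carrier R" and A: "A \<subseteq> carrier R"
    and P: "compatible_system R M A P" and rP: "rees_noetherian R M A P"
    and E: "compatible_system R M (insert a A) E"
  obtains j0 where "\<And>j i. j \<ge> j0 \<Longrightarrow> leading R M a P E (Suc j) i \<subseteq> leading R M a P E j i"
proof -
  let ?L = "leading R M a P E"
  have EA: "compatible_system R M A E" using E by (simp add: compatible_system_def)
  note Lc = leading_compatible[OF a A P EA]
  have Ls: "submodule (?L j i) R M" for j i by (rule compatible_systemD(1)[OF Lc])
  have step: "?L j i \<subseteq> ?L (Suc j) i" for j i by (rule leading_subset_Suc[OF a P E])
  have mono: "?L j i \<subseteq> ?L k i" if "j \<le> k" for i j k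
    by (rule lift_Suc_mono_le[where f = "\<lambda>j. ?L j i", OF step that])
  let ?U = "\<lambda>i. \<Union>j. ?L j i"
  have U: "compatible_system R M A ?U"
    unfolding compatible_system_def
  proof (intro conjI allI ballI)
    show "submodule (?U i) R M" for i by (rule submodule_UN_chain) (use Ls step in auto)
    show "b \<odot>\<^bsub>M\<^esub> x \<in> ?U (Suc i)" if "b \<in> A" "x \<in> ?U i" for i b x
      using that compatible_systemD(2)[OF Lc] by blast
  qed
  have UP: "?U i \<subseteq> P i" for i by (auto simp: leading_def)
  obtain i0 where i0: "\<And>i. i \<ge> i0 \<Longrightarrow> ?U (Suc i) \<subseteq> smult_span R M A (?U i)"
    using rees_noetherianD[OF rP U UP] by blast
  have "\<exists>k. \<forall>j\<ge>k. ?L j i = ?L k i" for i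
    by (rule noetherian_moduleD[OF nM]) (use Ls step in auto)
  then have "\<forall>i. \<exists>k. \<forall>j\<ge>k. ?L j i = ?L k i" by blast
  then obtain k where "\<forall>i. \<forall>j\<ge>k i. ?L j i = ?L (k i) i" by (rule choice[THEN exE])
  then have k: "\<And>i j. j \<ge> k i \<Longrightarrow> ?L j i = ?L (k i) i" by blast
  define j0 where "j0 = Max (k ` {..i0})"
  have kj0: "k i \<le> j0" if "i \<le> i0" for i unfolding j0_def using that by (intro Max_ge) auto
  have low: "?U i \<subseteq> ?L j i" if "i \<le> i0" "j \<ge> j0" for i j
  proof
    fix x assume "x \<in> ?U i"
    then obtain j' where "x \<in> ?L j' i" by blast
    then have "x \<in> ?L (max j' (k i)) i" using mono[of j' "max j' (k i)"] by auto
    then show "x \<in> ?L j i" using k[of i "max j' (k i)"] k[of i j] kj0[OF that(1)] that(2) by simp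
  qed
  have "?U i \<subseteq> ?L j i" if j: "j \<ge> j0" for i j
  proof (induction i)
    case 0
    show ?case by (rule low) (use j in auto)
  next
    case (Suc i)
    show ?case
    proof (cases "Suc i \<le> i0")
      case True
      then show ?thesis using low j by blast
    next
      case False
      then have "?U (Suc i) \<subseteq> smult_span R M A (?U i)" using i0 by simp
      also have "\<dots> \<subseteq> ?L j (Suc i)"
        by (rule smult_span_min[OF Ls]) (use Suc compatible_systemD(2)[OF Lc] in blast)
      finally show ?thesis .
    qed
  qed
  then have "?L (Suc j) i \<subseteq> ?L j i" if "j \<ge> j0" for j i using that by blast
  then show ?thesis by (rule that)
qed

text \<open>The Hilbert basis argument. An element \<open>a^j y + w\<close> of \<open>E (n + 1)\<close> with large \<open>n\<close> has
  large \<open>j\<close> or large \<open>i = n + 1 - j\<close>. In the first case \<open>y\<close> is already a leading coefficient for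
  \<open>a^(j - 1)\<close>, so the leading term comes from multiplying an element of \<open>E n\<close> by \<open>a\<close>. In the second,
  only the finitely many \<open>j \<le> j0\<close> remain, and for each of them \<open>P\<close> being Noetherian shows that \<open>y\<close> is
  a combination of leading coefficients in degree \<open>i - 1\<close> with factors from \<open>A\<close>. Either way the
  leading term can be subtracted, and induction on \<open>j\<close> finishes.\<close>

lemma rees_noetherian_insert:
  assumes nM: "noetherian_module R M" and a: "a \<in> carrier R" and A: "A \<subseteq> carrier R"
    and P: "compatible_system R M A P" and rP: "rees_noetherian R M A P"
  shows "rees_noetherian R M (insert a A) (\<lambda>n. layers R M a P (Suc n) n)"
  unfolding rees_noetherian_def
proof (intro allI impI)
  fix E
  assume "compatible_system R M (insert a A) E \<and> (\<forall>n. E n \<subseteq> layers R M a P (Suc n) n)"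
  then have E: "compatible_system R M (insert a A) E" and EW: "\<And>n. E n \<subseteq> layers R M a P (Suc n) n"
    by auto
  let ?L = "leading R M a P E" and ?W = "layers R M a P"
  have EA: "compatible_system R M A E" using E by (simp add: compatible_system_def)
  note Lc = leading_compatible[OF a A P EA]
  note Ps = compatible_systemD(1)[OF P] and Es = compatible_systemD(1)[OF E]
  have Ws: "submodule (?W k n) R M" for k n by (rule layers_submodule[OF a Ps])
  note Ic = submodule_Icarr[OF Ps] submodule_Icarr[OF Ws] submodule_Icarr[OF Es]
  have aA: "insert a A \<subseteq> carrier R" using a A by blast
  obtain j0 where j0: "\<And>j i. j \<ge> j0 \<Longrightarrow> ?L (Suc j) i \<subseteq> ?L j i"
    using leading_stabilises[OF nM a A P rP E] by blast
  have LP: "?L j i \<subseteq> P i" for i j by (auto simp: leading_def)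
  have "\<exists>m. \<forall>i\<ge>m. ?L j (Suc i) \<subseteq> smult_span R M A (?L j i)" for j
    by (rule rees_noetherianD[OF rP Lc[of j]]) (use LP in auto)
  then have "\<forall>j. \<exists>m. \<forall>i\<ge>m. ?L j (Suc i) \<subseteq> smult_span R M A (?L j i)" by blast
  then obtain m where "\<forall>j. \<forall>i\<ge>m j. ?L j (Suc i) \<subseteq> smult_span R M A (?L j i)"
    by (rule choice[THEN exE])
  then have m: "\<And>j i. i \<ge> m j \<Longrightarrow> ?L j (Suc i) \<subseteq> smult_span R M A (?L j i)" by blast
  define m0 where "m0 = Max (m ` {..j0})"
  have mm0: "m j \<le> m0" if "j \<le> j0" for j unfolding m0_def using that by (intro Max_ge) auto
  have "E (Suc n) \<subseteq> smult_span R M (insert a A) (E n)" if n: "n \<ge> m0 + j0" for n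
  proof -
    let ?G = "smult_span R M (insert a A) (E n)"
    have G: "submodule ?G R M" by (rule smult_span_submodule[OF aA submoduleE(1)[OF Es]])
    have GE: "?G \<subseteq> E (Suc n)"
      by (rule smult_span_min[OF Es]) (use compatible_systemD(2)[OF E] in blast)
    \<comment> \<open>Each leading term of degree \<open>n + 1\<close> is the leading term of an element of \<open>?G\<close>.\<close>
    have approx: "\<exists>w\<in>?W j (Suc n). (a [^] j) \<odot>\<^bsub>M\<^esub> y \<oplus>\<^bsub>M\<^esub> w \<in> ?G"
      if j: "j \<le> Suc n" and y: "y \<in> ?L j (Suc n - j)" for j y
    proof (cases "j \<le> j0")
      case False
      then obtain j' where j': "j = Suc j'" "j' \<ge> j0" by (cases j) auto
      then have "y \<in> ?L j' (n - j')" using y j0 by auto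
      then obtain w where w: "y \<in> P (n - j')" "w \<in> ?W j' n" "(a [^] j') \<odot>\<^bsub>M\<^esub> y \<oplus>\<^bsub>M\<^esub> w \<in> E n"
        using j j' unfolding leading_def by auto
      have "a \<odot>\<^bsub>M\<^esub> ((a [^] j') \<odot>\<^bsub>M\<^esub> y \<oplus>\<^bsub>M\<^esub> w) \<in> ?G" by (rule smult_span_gen) (use w in auto)
      then have "(a [^] j) \<odot>\<^bsub>M\<^esub> y \<oplus>\<^bsub>M\<^esub> a \<odot>\<^bsub>M\<^esub> w \<in> ?G"
        using w a Ic j' by (simp add: smult_r_distr smult_pow_Suc del: nat_pow_Suc)
      moreover have "a \<odot>\<^bsub>M\<^esub> w \<in> ?W j (Suc n)" using smult_layers_Suc[OF a Ps w(2)] j' by simp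
      ultimately show ?thesis by blast
    next
      case True
      let ?i = "n - j"
      have ij: "Suc n - j = Suc ?i" "?i + j = n" "?i \<ge> m j" using True n mm0[OF True] by auto
      have ap: "a [^] j \<in> carrier R" using a by simp
      \<comment> \<open>The coefficients that can be realised in \<open>?G\<close> form a submodule, so it suffices to realise
        the products that span.\<close>
      let ?Y = "{y \<in> carrier M. \<exists>w\<in>?W j (Suc n). (a [^] j) \<odot>\<^bsub>M\<^esub> y \<oplus>\<^bsub>M\<^esub> w \<in> ?G}"
      have "submodule ?Y R M"
      proof (rule submodule_if_closed)
        have "(a [^] j) \<odot>\<^bsub>M\<^esub> \<zero>\<^bsub>M\<^esub> \<oplus>\<^bsub>M\<^esub> \<zero>\<^bsub>M\<^esub> \<in> ?G" using ap submodule_zero[OF G] by simp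
        then show "\<zero>\<^bsub>M\<^esub> \<in> ?Y" using submodule_zero[OF Ws] by blast
        show "u \<oplus>\<^bsub>M\<^esub> v \<in> ?Y" if uv: "u \<in> ?Y" "v \<in> ?Y" for u v
        proof -
          from uv obtain w w' where h: "u \<in> carrier M" "v \<in> carrier M" "w \<in> ?W j (Suc n)"
            "w' \<in> ?W j (Suc n)" "(a [^] j) \<odot>\<^bsub>M\<^esub> u \<oplus>\<^bsub>M\<^esub> w \<in> ?G" "(a [^] j) \<odot>\<^bsub>M\<^esub> v \<oplus>\<^bsub>M\<^esub> w' \<in> ?G"
            by blast
          have "(a [^] j) \<odot>\<^bsub>M\<^esub> (u \<oplus>\<^bsub>M\<^esub> v) \<oplus>\<^bsub>M\<^esub> (w \<oplus>\<^bsub>M\<^esub> w') \<in> ?G"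
            using submoduleE(5)[OF G h(5,6)] h ap Ic by (simp add: add_lin)
          then show ?thesis using submoduleE(5)[OF Ws h(3,4)] h by blast
        qed
        show "c \<odot>\<^bsub>M\<^esub> u \<in> ?Y" if c: "c \<in> carrier R" and u: "u \<in> ?Y" for c u
        proof -
          from u obtain w where h: "u \<in> carrier M" "w \<in> ?W j (Suc n)"
            "(a [^] j) \<odot>\<^bsub>M\<^esub> u \<oplus>\<^bsub>M\<^esub> w \<in> ?G" by blast
          have "(a [^] j) \<odot>\<^bsub>M\<^esub> (c \<odot>\<^bsub>M\<^esub> u) \<oplus>\<^bsub>M\<^esub> c \<odot>\<^bsub>M\<^esub> w \<in> ?G"
            using submoduleE(4)[OF G c h(3)] h ap c Ic by (simp add: smult_lin_comm)
          then show ?thesis using submoduleE(4)[OF Ws c h(2)] h c by blast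
        qed
      qed auto
      moreover have "b \<odot>\<^bsub>M\<^esub> u \<in> ?Y" if b: "b \<in> A" and u: "u \<in> ?L j ?i" for b u
      proof -
        have bc: "b \<in> carrier R" using A b by blast
        from u obtain w where w: "u \<in> P ?i" "w \<in> ?W j n" "(a [^] j) \<odot>\<^bsub>M\<^esub> u \<oplus>\<^bsub>M\<^esub> w \<in> E n"
          unfolding leading_def ij(2) by blast
        have "b \<odot>\<^bsub>M\<^esub> ((a [^] j) \<odot>\<^bsub>M\<^esub> u \<oplus>\<^bsub>M\<^esub> w) \<in> ?G" by (rule smult_span_gen) (use b w in auto)
        then have "(a [^] j) \<odot>\<^bsub>M\<^esub> (b \<odot>\<^bsub>M\<^esub> u) \<oplus>\<^bsub>M\<^esub> b \<odot>\<^bsub>M\<^esub> w \<in> ?G"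
          using w ap bc Ic by (simp add: smult_lin_comm)
        then show ?thesis using smult_layers[OF a P b bc j w(2)] w(1) bc Ic by blast
      qed
      ultimately have "smult_span R M A (?L j ?i) \<subseteq> ?Y" by (rule smult_span_min)
      then show ?thesis using m[OF ij(3)] y ij(1) by auto
    qed
    have "E (Suc n) \<inter> ?W j (Suc n) \<subseteq> ?G" if "j \<le> Suc (Suc n)" for j
      using that
    proof (induction j)
      case 0
      then show ?case using submodule_zero[OF G] by auto
    next
      case (Suc j)
      let ?i = "Suc n - j"
      show ?case
      proof
        fix e assume e: "e \<in> E (Suc n) \<inter> ?W (Suc j) (Suc n)"
        then obtain y w where yw: "y \<in> P ?i" "w \<in> ?W j (Suc n)" "e = (a [^] j) \<odot>\<^bsub>M\<^esub> y \<oplus>\<^bsub>M\<^esub> w"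
          by auto
        have "?i + j = Suc n" using Suc.prems by simp
        then have "y \<in> ?L j ?i" using yw e unfolding leading_def by auto
        then obtain w' where w': "w' \<in> ?W j (Suc n)" "(a [^] j) \<odot>\<^bsub>M\<^esub> y \<oplus>\<^bsub>M\<^esub> w' \<in> ?G"
          using approx[of j y] Suc.prems by auto
        let ?g = "(a [^] j) \<odot>\<^bsub>M\<^esub> y \<oplus>\<^bsub>M\<^esub> w'"
        have ay: "(a [^] j) \<odot>\<^bsub>M\<^esub> y \<in> carrier M" using a yw Ic by simp
        have wc: "w \<in> carrier M" "w' \<in> carrier M" using yw w' Ic by auto
        have "e \<oplus>\<^bsub>M\<^esub> \<ominus>\<^bsub>M\<^esub> ?g = w \<oplus>\<^bsub>M\<^esub> \<ominus>\<^bsub>M\<^esub> w'"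
          using add_diff_add[OF ay wc] ay wc yw(3) by (simp add: M.a_comm)
        moreover have "w \<oplus>\<^bsub>M\<^esub> \<ominus>\<^bsub>M\<^esub> w' \<in> ?W j (Suc n)" by (rule submodule_diff[OF Ws yw(2) w'(1)])
        moreover have "e \<oplus>\<^bsub>M\<^esub> \<ominus>\<^bsub>M\<^esub> ?g \<in> E (Suc n)"
          by (rule submodule_diff[OF Es]) (use e w'(2) GE in auto)
        ultimately have "e \<oplus>\<^bsub>M\<^esub> \<ominus>\<^bsub>M\<^esub> ?g \<in> ?G" using Suc by auto
        then show "e \<in> ?G" using submodule_mem_if_diff_mem[OF G _ w'(2)] e Ic by blast
      qed
    qed
    from this[of "Suc (Suc n)"] show ?thesis using EW[of "Suc n"] by blast
  qed
  then show "\<exists>n0. \<forall>n\<ge>n0. E (Suc n) \<subseteq> smult_span R M (insert a A) (E n)" by blast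
qed

text \<open>Adjoining the elements of \<open>A\<close> one by one, starting from \<open>M\<close> concentrated in degree zero, where a
  compatible system has nothing left to generate in positive degrees.\<close>

lemma exists_rees_noetherian:
  assumes nM: "noetherian_module R M" and "finite A" "A \<subseteq> carrier R"
  obtains P where "compatible_system R M A P" "rees_noetherian R M A P" "P 0 = carrier M"
proof -
  have "\<exists>P. compatible_system R M A P \<and> rees_noetherian R M A P \<and> P 0 = carrier M"
    using assms(2,3)
  proof (induction A)
    case empty
    let ?P = "\<lambda>n::nat. if n = 0 then carrier M else {\<zero>\<^bsub>M\<^esub>}"
    have "E (Suc n) \<subseteq> smult_span R M {} (E n)" if "\<forall>n. E n \<subseteq> ?P n" for E n
    proof -
      have "E (Suc n) \<subseteq> {\<zero>\<^bsub>M\<^esub>}" using that by (metis nat.distinct(1))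
      also have "\<dots> \<subseteq> smult_span R M {} (E n)"
        using submodule_zero gen_submodule_submodule by (simp add: smult_span_def)
      finally show ?thesis .
    qed
    then have "rees_noetherian R M {} ?P" unfolding rees_noetherian_def by blast
    moreover have "compatible_system R M {} ?P"
      by (auto simp: compatible_system_def carrier_is_submodule zero_submodule)
    ultimately show ?case by (intro exI[of _ ?P]) simp
  next
    case (insert a A)
    then obtain P where P: "compatible_system R M A P" "rees_noetherian R M A P" "P 0 = carrier M"
      by auto
    have a: "a \<in> carrier R" and A: "A \<subseteq> carrier R" using insert.prems by auto
    note Ps = compatible_systemD(1)[OF P(1)]
    let ?Q = "\<lambda>n. layers R M a P (Suc n) n"
    have "b \<odot>\<^bsub>M\<^esub> x \<in> ?Q (Suc n)" if b: "b \<in> insert a A" and x: "x \<in> ?Q n" for b x n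
    proof (cases "b = a")
      case True
      then show ?thesis using smult_layers_Suc[OF a Ps x] by simp
    next
      case False
      then have "b \<odot>\<^bsub>M\<^esub> x \<in> layers R M a P (Suc n) (Suc n)"
        using smult_layers[OF a P(1) _ _ _ x] b A by blast
      then show ?thesis using layers_subset_Suc[of a P, OF a Ps] by blast
    qed
    then have "compatible_system R M (insert a A) ?Q"
      unfolding compatible_system_def using layers_submodule[of a P, OF a Ps] by blast
    moreover have "?Q 0 = carrier M"
    proof
      show "?Q 0 \<subseteq> carrier M" by (rule submoduleE(1)[OF layers_submodule[of a P, OF a Ps]])
      show "carrier M \<subseteq> ?Q 0"
      proof
        fix x assume x: "x \<in> carrier M"
        then have "x = (a [^] (0::nat)) \<odot>\<^bsub>M\<^esub> x \<oplus>\<^bsub>M\<^esub> \<zero>\<^bsub>M\<^esub>" using a by simp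
        then show "x \<in> ?Q 0"
          unfolding layers.simps using x P(3)
          by (intro CollectI exI[of _ x] exI[of _ "\<zero>\<^bsub>M\<^esub>"]) simp
      qed
    qed
    ultimately show ?case using rees_noetherian_insert[OF nM a A P(1,2)] by blast
  qed
  then show ?thesis using that by blast
qed

end

section \<open>Powers of an ideal acting on a module\<close>

abbreviation ideal_pow_mod ::
  "('a, 'c) ring_scheme \<Rightarrow> ('a, 'b, 'd) module_scheme \<Rightarrow> 'a set \<Rightarrow> nat \<Rightarrow> 'b set" where
  "ideal_pow_mod R M I n \<equiv> ideal_mod R M (ideal_pow R I n)"

lemma (in cring) ideal_pow_0: "ideal_pow R I 0 = carrier R"
  by (simp add: ideals_set_def)

lemma (in cring) ideal_pow_1:
  assumes "ideal I R" shows "ideal_pow R I 1 = I"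
  using assms ideal_prod_one[OF assms] ideal_prod_commute[OF assms oneideal]
  by (simp add: ideals_set_def)

lemma (in cring) pow_mem_ideal_pow:
  assumes "ideal I R" "x \<in> I"
  shows "x [^] n \<in> ideal_pow R I n"
proof (induction n)
  case 0
  then show ?case by (simp add: ideals_set_def)
next
  case (Suc n)
  have "ideal_pow R I (Suc n) = ideal_pow R I n \<cdot> I" by (simp add: ideals_set_def)
  then show ?case using Suc assms(2) by (simp add: ideal_prod.prod)
qed

context module
begin

lemma pow_mod_submodule: "ideal I R \<Longrightarrow> submodule (ideal_pow_mod R M I n) R M"
  by (rule ideal_mod_submodule[OF ideal_pow_ideal])

lemma smult_pow_mod:
  assumes "ideal I R" "a \<in> ideal_pow R I m" "y \<in> ideal_pow_mod R M I n"
  shows "a \<odot>\<^bsub>M\<^esub> y \<in> ideal_pow_mod R M I (m + n)"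
  using ideal_mod_prod[OF ideal_pow_ideal ideal_pow_ideal assms(2,3)] assms(1)
  by (simp add: ideal_pow_add)

lemma smult_pow_mod_Suc:
  assumes "ideal I R" "b \<in> I" "y \<in> ideal_pow_mod R M I n"
  shows "b \<odot>\<^bsub>M\<^esub> y \<in> ideal_pow_mod R M I (Suc n)"
  using smult_pow_mod[OF assms(1), of b 1 y n] assms ideal_pow_1[OF assms(1)] by simp

text \<open>Generators of \<open>I^(m+n) M\<close> may be taken to be products of \<open>I^m\<close> with \<open>I^n M\<close>. With \<open>m = 1\<close> this
  climbs one degree at a time.\<close>

lemma pow_mod_add_subset:
  assumes I: "ideal I R" and N: "submodule N R M"
    and *: "\<And>a y. a \<in> ideal_pow R I m \<Longrightarrow> y \<in> ideal_pow_mod R M I n \<Longrightarrow> a \<odot>\<^bsub>M\<^esub> y \<in> N"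
  shows "ideal_pow_mod R M I (m + n) \<subseteq> N"
  unfolding ideal_mod_def[of R M "ideal_pow R I (m + n)"]
proof (rule gen_submodule_min[OF N], safe)
  fix c x assume c: "c \<in> ideal_pow R I (m + n)" and x: "x \<in> carrier M"
  have "ideal_pow R I m \<cdot> ideal_pow R I n \<subseteq> {a \<in> carrier R. a \<odot>\<^bsub>M\<^esub> x \<in> N}"
  proof (rule ideal_prod_subset[OF smult_ideal[OF N x]])
    fix b d assume b: "b \<in> ideal_pow R I m" and d: "d \<in> ideal_pow R I n"
    have "b \<in> carrier R" "d \<in> carrier R"
      using b d ideal.Icarr[OF ideal_pow_ideal[OF I]] by auto
    moreover have "b \<odot>\<^bsub>M\<^esub> (d \<odot>\<^bsub>M\<^esub> x) \<in> N" by (rule *[OF b ideal_mod_gen[OF d x]])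
    ultimately show "b \<otimes> d \<in> {a \<in> carrier R. a \<odot>\<^bsub>M\<^esub> x \<in> N}" using x by (simp add: smult_assoc1)
  qed
  then show "c \<odot>\<^bsub>M\<^esub> x \<in> N" using c ideal_pow_add[OF I] by auto
qed

lemma pow_mod_antimono:
  assumes I: "ideal I R" and "n \<le> k"
  shows "ideal_pow_mod R M I k \<subseteq> ideal_pow_mod R M I n"
proof -
  have "ideal_pow_mod R M I ((k - n) + n) \<subseteq> ideal_pow_mod R M I n"
    by (rule pow_mod_add_subset[OF I pow_mod_submodule[OF I]])
      (use submoduleE(4)[OF pow_mod_submodule[OF I]] ideal.Icarr[OF ideal_pow_ideal[OF I]] in blast)
  then show ?thesis using assms(2) by simp
qed

lemma ideal_pow_mod_subset_system:
  assumes A: "A \<subseteq> carrier R" and P: "compatible_system R M A P" and P0: "P 0 = carrier M"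
  shows "ideal_pow_mod R M (Idl A) n \<subseteq> P n"
proof (induction n)
  case 0
  show ?case unfolding P0 by (rule submoduleE(1)[OF pow_mod_submodule[OF genideal_ideal[OF A]]])
next
  case (Suc n)
  note Ps = compatible_systemD(1)[OF P] and I = genideal_ideal[OF A]
  have "ideal_pow_mod R M (Idl A) (1 + n) \<subseteq> P (Suc n)"
  proof (rule pow_mod_add_subset[OF I Ps])
    fix a y assume a: "a \<in> ideal_pow R (Idl A) 1" and "y \<in> ideal_pow_mod R M (Idl A) n"
    then have y: "y \<in> P n" using Suc by blast
    have yM: "y \<in> carrier M" by (rule submodule_Icarr[OF Ps y])
    have "Idl A \<subseteq> {a \<in> carrier R. a \<odot>\<^bsub>M\<^esub> y \<in> P (Suc n)}"
      by (rule genideal_minimal[OF smult_ideal[OF Ps yM]])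
        (use A y compatible_systemD(2)[OF P] in blast)
    then show "a \<odot>\<^bsub>M\<^esub> y \<in> P (Suc n)" using a ideal_pow_1[OF I] by auto
  qed
  then show ?case by simp
qed

text \<open>The graded module built from finitely many generators of \<open>I\<close> starts with \<open>M\<close> and is closed under
  multiplication by the generators, so it contains \<open>I^n M\<close> in degree \<open>n\<close>. Being Noetherian passes to
  the smaller module at once.\<close>

theorem rees_noetherian_ideal_pow:
  assumes noeth: "noetherian_ring R" and nM: "noetherian_module R M" and I: "ideal I R"
  shows "rees_noetherian R M I (ideal_pow_mod R M I)"
  unfolding rees_noetherian_def
proof (intro allI impI)
  fix E assume *: "compatible_system R M I E \<and> (\<forall>n. E n \<subseteq> ideal_pow_mod R M I n)"
  then have E: "compatible_system R M I E" and EI: "\<And>n. E n \<subseteq> ideal_pow_mod R M I n" by auto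
  obtain A where A: "A \<subseteq> carrier R" "finite A" "I = Idl A"
    using noetherian_ring.finetely_gen[OF noeth I] by blast
  have AI: "A \<subseteq> I" using A genideal_self by blast
  obtain P where P: "compatible_system R M A P" "rees_noetherian R M A P" "P 0 = carrier M"
    using exists_rees_noetherian[OF nM A(2,1)] by blast
  have "compatible_system R M A E" using E AI unfolding compatible_system_def by blast
  moreover have "E n \<subseteq> P n" for n
    using EI[of n] ideal_pow_mod_subset_system[OF A(1) P(1,3), of n] A(3) by simp
  ultimately obtain n0 where n0: "\<And>n. n \<ge> n0 \<Longrightarrow> E (Suc n) \<subseteq> smult_span R M A (E n)"
    using rees_noetherianD[OF P(2)] by blast
  have "smult_span R M A (E n) \<subseteq> smult_span R M I (E n)" for n
    by (rule smult_span_mono)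
      (use AI ideal.Icarr[OF I] submoduleE(1)[OF compatible_systemD(1)[OF E]] in auto)
  then show "\<exists>n0. \<forall>n\<ge>n0. E (Suc n) \<subseteq> smult_span R M I (E n)" using n0 by blast
qed

lemma ideal_pow_Suc_smult:
  assumes I: "ideal I R" and N: "submodule N R M" and y: "y \<in> carrier M"
    and *: "\<And>b. b \<in> I \<Longrightarrow> \<forall>a\<in>ideal_pow R I j. a \<odot>\<^bsub>M\<^esub> (b \<odot>\<^bsub>M\<^esub> y) \<in> N"
    and a: "a \<in> ideal_pow R I (Suc j)"
  shows "a \<odot>\<^bsub>M\<^esub> y \<in> N"
proof -
  have "ideal_pow R I j \<cdot> I \<subseteq> {a \<in> carrier R. a \<odot>\<^bsub>M\<^esub> y \<in> N}"
  proof (rule ideal_prod_subset[OF smult_ideal[OF N y]])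
    fix c b assume c: "c \<in> ideal_pow R I j" and b: "b \<in> I"
    have "c \<in> carrier R" "b \<in> carrier R"
      using b c ideal.Icarr[OF ideal_pow_ideal[OF I]] ideal.Icarr[OF I] by auto
    then show "c \<otimes> b \<in> {a \<in> carrier R. a \<odot>\<^bsub>M\<^esub> y \<in> N}"
      using *[OF b] c y by (simp add: smult_assoc1)
  qed
  moreover have "ideal_pow R I (Suc j) = ideal_pow R I j \<cdot> I" by (simp add: ideals_set_def)
  ultimately show ?thesis using a by auto
qed

text \<open>Let \<open>D n j\<close> be the set of \<open>y \<in> I^n M\<close> whose class in \<open>I^n M / I^(n+1) M\<close> is killed by \<open>I^j\<close>
  as a graded operator, that is, \<open>I^j y \<subseteq> I^(n+j+1) M\<close>. The unions \<open>E n\<close> over \<open>j\<close> form a compatible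
  system, hence are generated in degrees up to some \<open>n0\<close>; the chain condition yields one exponent
  \<open>j0\<close> that works for all of \<open>E n0\<close>. Each further factor from \<open>I\<close> lowers the exponent by one, so
  from degree \<open>n0 + j0\<close> on the exponent is zero and the classes vanish.\<close>

lemma associated_graded_torsion_bounded:
  assumes noeth: "noetherian_ring R" and nM: "noetherian_module R M" and I: "ideal I R"
  obtains c where "\<And>n j y. n \<ge> c \<Longrightarrow> y \<in> ideal_pow_mod R M I n \<Longrightarrow>
      \<forall>a\<in>ideal_pow R I j. a \<odot>\<^bsub>M\<^esub> y \<in> ideal_pow_mod R M I (Suc (n + j)) \<Longrightarrow>
      y \<in> ideal_pow_mod R M I (Suc n)"
proof -
  let ?P = "ideal_pow_mod R M I"
  let ?D = "\<lambda>n j. {y \<in> ?P n. \<forall>a\<in>ideal_pow R I j. a \<odot>\<^bsub>M\<^esub> y \<in> ?P (Suc (n + j))}"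
  note Ps = pow_mod_submodule[OF I] and pI = ideal_pow_ideal[OF I]
  have pR: "ideal_pow R I j \<subseteq> carrier R" for j using ideal.Icarr[OF pI] by blast
  have D: "submodule (?D n j) R M" for n j
  proof -
    have eq: "?D n j = ?P n \<inter> {y \<in> carrier M. \<forall>a\<in>ideal_pow R I j. a \<odot>\<^bsub>M\<^esub> y \<in> ?P (Suc (n + j))}"
      using submodule_Icarr[OF Ps] by blast
    show ?thesis unfolding eq by (rule submodule_Int[OF Ps submodule_colon[OF Ps pR]])
  qed
  have D_Suc: "?D n j \<subseteq> ?D n (Suc j)" for n j
  proof
    fix y assume y: "y \<in> ?D n j"
    have "a \<odot>\<^bsub>M\<^esub> y \<in> ?P (Suc (n + Suc j))" if a: "a \<in> ideal_pow R I (Suc j)" for a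
    proof (rule ideal_pow_Suc_smult[OF I Ps _ _ a])
      show yM: "y \<in> carrier M" using y submodule_Icarr[OF Ps] by blast
      show "\<forall>a\<in>ideal_pow R I j. a \<odot>\<^bsub>M\<^esub> (b \<odot>\<^bsub>M\<^esub> y) \<in> ?P (Suc (n + Suc j))" if b: "b \<in> I" for b
      proof
        fix a assume a: "a \<in> ideal_pow R I j"
        have "a \<odot>\<^bsub>M\<^esub> (b \<odot>\<^bsub>M\<^esub> y) = b \<odot>\<^bsub>M\<^esub> (a \<odot>\<^bsub>M\<^esub> y)"
          using a pR b ideal.Icarr[OF I] yM by (simp add: smult_assoc1[symmetric] m_comm subset_iff)
        then show "a \<odot>\<^bsub>M\<^esub> (b \<odot>\<^bsub>M\<^esub> y) \<in> ?P (Suc (n + Suc j))"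
          using smult_pow_mod_Suc[OF I b, of "a \<odot>\<^bsub>M\<^esub> y" "Suc (n + j)"] y a by simp
      qed
    qed
    then show "y \<in> ?D n (Suc j)" using y by blast
  qed
  have smult_D: "b \<odot>\<^bsub>M\<^esub> y \<in> ?D (Suc n) (j - 1)" if b: "b \<in> I" and y: "y \<in> ?D n j" for b y n j
  proof -
    have bR: "b \<in> carrier R" using ideal.Icarr[OF I b] .
    have yM: "y \<in> carrier M" using y submodule_Icarr[OF Ps] by blast
    have "a \<odot>\<^bsub>M\<^esub> (b \<odot>\<^bsub>M\<^esub> y) \<in> ?P (Suc (Suc n + (j - 1)))" if a: "a \<in> ideal_pow R I (j - 1)" for a
    proof (cases j)
      case 0
      have "\<one> \<odot>\<^bsub>M\<^esub> y \<in> ?P (Suc n)" using y 0 ideal_pow_0 by auto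
      then have "y \<in> ?P (Suc n)" using yM by (simp only: smult_one)
      then have "b \<odot>\<^bsub>M\<^esub> y \<in> ?P (Suc (Suc n))" by (rule smult_pow_mod_Suc[OF I b])
      then have "a \<odot>\<^bsub>M\<^esub> (b \<odot>\<^bsub>M\<^esub> y) \<in> ?P (Suc (Suc n))"
        using submoduleE(4)[OF Ps] a pR by blast
      then show ?thesis using 0 by simp
    next
      case (Suc i)
      have "a \<otimes> b \<in> ideal_pow R I j"
        using ideal_prod.prod[OF a b, of R] Suc by (simp add: ideals_set_def)
      then have "(a \<otimes> b) \<odot>\<^bsub>M\<^esub> y \<in> ?P (Suc (n + j))" using y by blast
      then show ?thesis using Suc a pR bR yM by (simp add: smult_assoc1 subset_iff)
    qed
    then show ?thesis using smult_pow_mod_Suc[OF I b] y by blast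
  qed
  let ?E = "\<lambda>n. \<Union>j. ?D n j"
  have Es: "submodule (?E n) R M" for n by (rule submodule_UN_chain, rule D, rule D_Suc)
  have Ec: "compatible_system R M I ?E"
    unfolding compatible_system_def
  proof (intro conjI allI ballI)
    show "b \<odot>\<^bsub>M\<^esub> y \<in> ?E (Suc n)" if "b \<in> I" "y \<in> ?E n" for n b y
    proof -
      from that(2) obtain j where "y \<in> ?D n j" by (rule UN_E)
      from smult_D[OF that(1) this] show ?thesis by (rule UN_I[OF UNIV_I])
    qed
  qed (rule Es)
  have EP: "?E n \<subseteq> ?P n" for n by blast
  obtain n0 where n0: "\<And>n. n \<ge> n0 \<Longrightarrow> ?E (Suc n) \<subseteq> smult_span R M I (?E n)"
    using rees_noetherianD[of R M I ?P ?E, OF rees_noetherian_ideal_pow[OF noeth nM I] Ec EP] by blast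
  obtain j0 where j0: "\<forall>j\<ge>j0. ?D n0 j = ?D n0 j0"
    using noetherian_moduleD[of R M "?D n0", OF nM D D_Suc] by (rule exE)
  have mono: "?D n i \<subseteq> ?D n j" if "i \<le> j" for i j n
    by (rule lift_Suc_mono_le[where f = "?D n", OF D_Suc that])
  \<comment> \<open>The truncated difference is intended: an exponent that has reached zero stays there.\<close>
  have shrink: "?E (n0 + q) \<subseteq> ?D (n0 + q) (j0 - q)" for q
  proof (induction q)
    case 0
    have "?D n0 j \<subseteq> ?D n0 j0" for j
      using mono[of j "max j j0" n0] j0[rule_format, of "max j j0"] by simp
    then show ?case by (intro UN_least) simp
  next
    case (Suc q)
    have "?E (Suc (n0 + q)) \<subseteq> smult_span R M I (?E (n0 + q))" by (rule n0) simp
    also have "\<dots> \<subseteq> ?D (Suc (n0 + q)) (j0 - q - 1)"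
      by (rule smult_span_min[OF D]) (rule smult_D, assumption, rule subsetD[OF Suc])
    finally show ?case by simp
  qed
  show ?thesis
  proof (rule that[of "n0 + j0"])
    fix n j y
    assume n: "n \<ge> n0 + j0" and y: "y \<in> ?P n"
      and *: "\<forall>a\<in>ideal_pow R I j. a \<odot>\<^bsub>M\<^esub> y \<in> ?P (Suc (n + j))"
    from y * have "y \<in> ?E n" by blast
    then have "y \<in> ?D n 0" using shrink[of "n - n0"] n by auto
    then have "\<one> \<odot>\<^bsub>M\<^esub> y \<in> ?P (Suc n)" using ideal_pow_0 by auto
    then show "y \<in> ?P (Suc n)" using y submodule_Icarr[OF Ps] by auto
  qed
qed

end

section \<open>The Ratliff--Rush filtration\<close>

context module
begin

lemma colon_pow_mono:
  assumes I: "ideal I R" and f: "f \<in> carrier R"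
    and *: "\<forall>y\<in>ideal_pow_mod R M I k. f \<odot>\<^bsub>M\<^esub> y \<in> ideal_pow_mod R M I (n + k)" and "k \<le> l"
  shows "\<forall>y\<in>ideal_pow_mod R M I l. f \<odot>\<^bsub>M\<^esub> y \<in> ideal_pow_mod R M I (n + l)"
  using colon_step[OF I, of n k "l - k"] assms by (auto simp: colon_def)

text \<open>Admitting \<open>k = 0\<close> changes nothing, since the colon ideals increase with \<open>k\<close>, and makes the
  description valid for \<open>n = 0\<close> as well.\<close>

lemma mem_rr_filtration_iff:
  assumes I: "ideal I R"
  shows "f \<in> rr_filtration R M I n \<longleftrightarrow>
    f \<in> carrier R \<and> (\<exists>k. \<forall>y\<in>ideal_pow_mod R M I k. f \<odot>\<^bsub>M\<^esub> y \<in> ideal_pow_mod R M I (n + k))"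
proof (cases "n = 0")
  case True
  have "f \<odot>\<^bsub>M\<^esub> y \<in> ideal_pow_mod R M I 0" if "f \<in> carrier R" "y \<in> ideal_pow_mod R M I 0" for y
    using submoduleE(4)[OF pow_mod_submodule[OF I]] that by blast
  then have "\<exists>k. \<forall>y\<in>ideal_pow_mod R M I k. f \<odot>\<^bsub>M\<^esub> y \<in> ideal_pow_mod R M I (0 + k)"
    if "f \<in> carrier R" using that by (intro exI[of _ 0] ballI) (simp only: add_0)
  then show ?thesis unfolding True rr_filtration_0[OF I] by blast
next
  case False
  have "\<exists>k\<in>{1..}. \<forall>y\<in>ideal_pow_mod R M I k. f \<odot>\<^bsub>M\<^esub> y \<in> ideal_pow_mod R M I (n + k)"
    if "f \<in> carrier R" "\<forall>y\<in>ideal_pow_mod R M I k. f \<odot>\<^bsub>M\<^esub> y \<in> ideal_pow_mod R M I (n + k)" for k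
    using colon_pow_mono[OF I that, of "Suc k"] by (intro bexI[of _ "Suc k"]) auto
  then show ?thesis using False rr_filtration_eq[OF I, of n] by (auto simp: colon_def)
qed

lemma rr_filtration_ideal:
  assumes I: "ideal I R"
  shows "ideal (rr_filtration R M I n) R"
proof (rule ideal_if_closed)
  let ?P = "ideal_pow_mod R M I"
  note Ps = pow_mod_submodule[OF I]
  show "rr_filtration R M I n \<subseteq> carrier R" by (auto simp: mem_rr_filtration_iff[OF I])
  show "\<zero> \<in> rr_filtration R M I n"
    using submodule_zero[OF Ps] submodule_Icarr[OF Ps] by (auto simp: mem_rr_filtration_iff[OF I])
  show "f \<oplus> g \<in> rr_filtration R M I n"
    if fg: "f \<in> rr_filtration R M I n" "g \<in> rr_filtration R M I n" for f g
  proof -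
    from fg obtain k l where h: "f \<in> carrier R" "\<forall>y\<in>?P k. f \<odot>\<^bsub>M\<^esub> y \<in> ?P (n + k)"
      "g \<in> carrier R" "\<forall>y\<in>?P l. g \<odot>\<^bsub>M\<^esub> y \<in> ?P (n + l)"
      unfolding mem_rr_filtration_iff[OF I] by blast
    let ?m = "max k l"
    have "(f \<oplus> g) \<odot>\<^bsub>M\<^esub> y \<in> ?P (n + ?m)" if y: "y \<in> ?P ?m" for y
    proof -
      have "f \<odot>\<^bsub>M\<^esub> y \<in> ?P (n + ?m)" "g \<odot>\<^bsub>M\<^esub> y \<in> ?P (n + ?m)"
        using colon_pow_mono[OF I h(1,2), of ?m] colon_pow_mono[OF I h(3,4), of ?m] y by auto
      then show ?thesis
        using submoduleE(5)[OF Ps] h(1,3) submodule_Icarr[OF Ps y] by (simp add: smult_l_distr)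
    qed
    then show ?thesis using h(1,3) unfolding mem_rr_filtration_iff[OF I] by blast
  qed
  show "c \<otimes> f \<in> rr_filtration R M I n"
    if c: "c \<in> carrier R" and f: "f \<in> rr_filtration R M I n" for c f
  proof -
    from f obtain k where h: "f \<in> carrier R" "\<forall>y\<in>?P k. f \<odot>\<^bsub>M\<^esub> y \<in> ?P (n + k)"
      unfolding mem_rr_filtration_iff[OF I] by blast
    have "(c \<otimes> f) \<odot>\<^bsub>M\<^esub> y \<in> ?P (n + k)" if y: "y \<in> ?P k" for y
      using h c y submodule_Icarr[OF Ps y] submoduleE(4)[OF Ps] by (simp add: smult_assoc1)
    then show ?thesis using h(1) c unfolding mem_rr_filtration_iff[OF I] by blast
  qed
qed

lemma rr_filtration_Suc_subset:
  assumes I: "ideal I R"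
  shows "rr_filtration R M I (Suc n) \<subseteq> rr_filtration R M I n"
proof -
  have "ideal_pow_mod R M I (Suc n + k) \<subseteq> ideal_pow_mod R M I (n + k)" for k
    by (rule pow_mod_antimono[OF I]) simp
  then show ?thesis unfolding subset_iff mem_rr_filtration_iff[OF I] by blast
qed

lemma smult_rr_filtration:
  assumes I: "ideal I R" and b: "b \<in> I" and f: "f \<in> rr_filtration R M I n"
  shows "b \<otimes> f \<in> rr_filtration R M I (Suc n)"
proof -
  let ?P = "ideal_pow_mod R M I"
  from f obtain k where h: "f \<in> carrier R" "\<forall>y\<in>?P k. f \<odot>\<^bsub>M\<^esub> y \<in> ?P (n + k)"
    unfolding mem_rr_filtration_iff[OF I] by blast
  have bR: "b \<in> carrier R" using ideal.Icarr[OF I b] .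
  have "(b \<otimes> f) \<odot>\<^bsub>M\<^esub> y \<in> ?P (Suc n + k)" if y: "y \<in> ?P k" for y
    using smult_pow_mod_Suc[OF I b, of "f \<odot>\<^bsub>M\<^esub> y" "n + k"] h bR y
      submodule_Icarr[OF pow_mod_submodule[OF I] y] by (simp only: smult_assoc1 add_Suc)
  then show ?thesis using h(1) bR unfolding mem_rr_filtration_iff[OF I] by blast
qed

text \<open>For \<open>y \<in> I^c M\<close> some power \<open>I^k\<close> carries \<open>f y\<close> into \<open>I^(n+c+k) M\<close>. As long as \<open>f y\<close> is only known
  to lie in \<open>I^(p+c) M\<close> with \<open>p < n\<close>, its class in the associated graded module is thus torsion; by
  the choice of \<open>c\<close> this class is zero, and \<open>p\<close> can be increased until it reaches \<open>n\<close>.\<close>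

lemma rr_filtration_uniform:
  assumes noeth: "noetherian_ring R" and nM: "noetherian_module R M" and I: "ideal I R"
  obtains c where "\<And>n f y. f \<in> rr_filtration R M I n \<Longrightarrow> y \<in> ideal_pow_mod R M I c \<Longrightarrow>
      f \<odot>\<^bsub>M\<^esub> y \<in> ideal_pow_mod R M I (n + c)"
proof -
  let ?P = "ideal_pow_mod R M I"
  note Ps = pow_mod_submodule[OF I]
  obtain c where c: "\<And>n j y. n \<ge> c \<Longrightarrow> y \<in> ?P n \<Longrightarrow>
      \<forall>a\<in>ideal_pow R I j. a \<odot>\<^bsub>M\<^esub> y \<in> ?P (Suc (n + j)) \<Longrightarrow> y \<in> ?P (Suc n)"
    using associated_graded_torsion_bounded[OF noeth nM I] by blast
  show ?thesis
  proof (rule that[of c])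
    fix n f y assume f: "f \<in> rr_filtration R M I n" and y: "y \<in> ?P c"
    then obtain k where h: "f \<in> carrier R" "\<forall>y\<in>?P k. f \<odot>\<^bsub>M\<^esub> y \<in> ?P (n + k)"
      unfolding mem_rr_filtration_iff[OF I] by blast
    have yM: "y \<in> carrier M" by (rule submodule_Icarr[OF Ps y])
    have z: "a \<odot>\<^bsub>M\<^esub> (f \<odot>\<^bsub>M\<^esub> y) \<in> ?P (n + (k + c))" if a: "a \<in> ideal_pow R I k" for a
    proof -
      have "a \<in> carrier R" using ideal.Icarr[OF ideal_pow_ideal[OF I] a] .
      then have "a \<odot>\<^bsub>M\<^esub> (f \<odot>\<^bsub>M\<^esub> y) = f \<odot>\<^bsub>M\<^esub> (a \<odot>\<^bsub>M\<^esub> y)"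
        using h(1) yM by (simp add: smult_assoc1[symmetric] m_comm)
      moreover have "f \<odot>\<^bsub>M\<^esub> (a \<odot>\<^bsub>M\<^esub> y) \<in> ?P (n + (k + c))"
        using colon_pow_mono[OF I h, of "k + c"] smult_pow_mod[OF I a y] by auto
      ultimately show ?thesis by simp
    qed
    have "p \<le> n \<Longrightarrow> f \<odot>\<^bsub>M\<^esub> y \<in> ?P (p + c)" for p
    proof (induction p)
      case 0
      show ?case using submoduleE(4)[OF Ps h(1) y] by simp
    next
      case (Suc p)
      have "?P (n + (k + c)) \<subseteq> ?P (Suc (p + c + k))" by (rule pow_mod_antimono[OF I]) (use Suc in simp)
      then have "f \<odot>\<^bsub>M\<^esub> y \<in> ?P (Suc (p + c))" by (intro c[of _ _ k]) (use Suc z in auto)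
      then show ?case by (simp only: add_Suc)
    qed
    then show "f \<odot>\<^bsub>M\<^esub> y \<in> ?P (n + c)" by simp
  qed
qed

text \<open>Evaluation at the points of \<open>Y\<close> embeds \<open>H n\<close> into a finite power of \<open>P (n + k)\<close>. Rather than
  forming this power, the points are split off one at a time: the values at \<open>y\<close> form a compatible system
  inside \<open>P\<close>, and the elements that vanish at \<open>y\<close> are still separated by the remaining points. If
  \<open>f y = g y\<close> with \<open>g \<in> I H n\<close>, then \<open>f - g\<close> belongs to this kernel.\<close>

lemma eventually_equigenerated_if_separated:
  assumes I: "ideal I R" and rP: "rees_noetherian R M I P" and P: "\<And>n. submodule (P n) R M"
    and Y: "finite Y" "Y \<subseteq> carrier M"
  shows "(\<And>n. ideal (H n) R) \<Longrightarrow> (\<And>n b f. b \<in> I \<Longrightarrow> f \<in> H n \<Longrightarrow> b \<otimes> f \<in> H (Suc n)) \<Longrightarrow>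
    (\<And>n f y. f \<in> H n \<Longrightarrow> y \<in> Y \<Longrightarrow> f \<odot>\<^bsub>M\<^esub> y \<in> P (n + k)) \<Longrightarrow>
    (\<And>n f. f \<in> H n \<Longrightarrow> \<forall>y\<in>Y. f \<odot>\<^bsub>M\<^esub> y = \<zero>\<^bsub>M\<^esub> \<Longrightarrow> f = \<zero>) \<Longrightarrow>
    \<exists>n0. \<forall>n\<ge>n0. H (Suc n) \<subseteq> I \<cdot> H n"
  using Y
proof (induction Y arbitrary: H)
  case empty
  have "H (Suc n) \<subseteq> I \<cdot> H n" for n
  proof -
    have "H (Suc n) \<subseteq> {\<zero>}" using empty.prems(4) by blast
    also have "\<dots> \<subseteq> I \<cdot> H n"
      using additive_subgroup.zero_closed[OF ideal.axioms(1)[OF ideal_prod_is_ideal[OF I empty.prems(1)]]]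
      by simp
    finally show ?thesis .
  qed
  then show ?case by blast
next
  case (insert y Y)
  note H = insert.prems(1) and IH = insert.prems(2) and HP = insert.prems(3)
  have y: "y \<in> carrier M" using insert.prems by simp
  have HR: "f \<in> carrier R" if "f \<in> H n" for f n using ideal.Icarr[OF H that] .
  have IR: "b \<in> carrier R" if "b \<in> I" for b using ideal.Icarr[OF I that] .
  let ?K = "\<lambda>n. {f \<in> H n. f \<odot>\<^bsub>M\<^esub> y = \<zero>\<^bsub>M\<^esub>}"
  have "\<exists>n0. \<forall>n\<ge>n0. ?K (Suc n) \<subseteq> I \<cdot> ?K n"
  proof (rule insert.IH)
    show "ideal (?K n) R" for n
    proof -
      have "?K n = H n \<inter> {a \<in> carrier R. a \<odot>\<^bsub>M\<^esub> y \<in> {\<zero>\<^bsub>M\<^esub>}}" using HR by auto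
      then show ?thesis using i_intersect[OF H smult_ideal[OF zero_submodule y]] by simp
    qed
    show "b \<otimes> f \<in> ?K (Suc n)" if "b \<in> I" "f \<in> ?K n" for n b f
      using that IH HR IR y by (auto simp: smult_assoc1)
    show "f \<odot>\<^bsub>M\<^esub> z \<in> P (n + k)" if "f \<in> ?K n" "z \<in> Y" for n f z
      using that HP by blast
    show "f = \<zero>" if "f \<in> ?K n" "\<forall>z\<in>Y. f \<odot>\<^bsub>M\<^esub> z = \<zero>\<^bsub>M\<^esub>" for n f
      using that insert.prems(4) by blast
  qed (use insert.prems in auto)
  then obtain n1 where n1: "\<And>n. n \<ge> n1 \<Longrightarrow> ?K (Suc n) \<subseteq> I \<cdot> ?K n" by blast
  \<comment> \<open>The values at \<open>y\<close>, shifted by \<open>k\<close> so that the degree \<open>m\<close> part lies in \<open>P m\<close>.\<close>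
  let ?E = "\<lambda>m. if m < k then {\<zero>\<^bsub>M\<^esub>} else (\<lambda>f. f \<odot>\<^bsub>M\<^esub> y) ` H (m - k)"
  have img: "submodule ((\<lambda>f. f \<odot>\<^bsub>M\<^esub> y) ` J) R M" if J: "ideal J R" for J
  proof (rule submodule_if_closed)
    note Ja = ideal.axioms(1)[OF J]
    show "(\<lambda>f. f \<odot>\<^bsub>M\<^esub> y) ` J \<subseteq> carrier M" using ideal.Icarr[OF J] y by auto
    show "\<zero>\<^bsub>M\<^esub> \<in> (\<lambda>f. f \<odot>\<^bsub>M\<^esub> y) ` J"
      using additive_subgroup.zero_closed[OF Ja] y by (auto intro!: image_eqI[of _ _ \<zero>])
    show "u \<oplus>\<^bsub>M\<^esub> v \<in> (\<lambda>f. f \<odot>\<^bsub>M\<^esub> y) ` J"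
      if uv: "u \<in> (\<lambda>f. f \<odot>\<^bsub>M\<^esub> y) ` J" "v \<in> (\<lambda>f. f \<odot>\<^bsub>M\<^esub> y) ` J" for u v
    proof -
      from uv obtain f g where "f \<in> J" "u = f \<odot>\<^bsub>M\<^esub> y" "g \<in> J" "v = g \<odot>\<^bsub>M\<^esub> y" by blast
      then show ?thesis
        using ideal.Icarr[OF J] y additive_subgroup.a_closed[OF Ja, of f g]
        by (intro image_eqI[of _ _ "f \<oplus> g"]) (simp_all add: smult_l_distr)
    qed
    show "c \<odot>\<^bsub>M\<^esub> u \<in> (\<lambda>f. f \<odot>\<^bsub>M\<^esub> y) ` J" if c: "c \<in> carrier R" and u: "u \<in> (\<lambda>f. f \<odot>\<^bsub>M\<^esub> y) ` J" for c u
    proof -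
      from u obtain f where "f \<in> J" "u = f \<odot>\<^bsub>M\<^esub> y" by blast
      then show ?thesis
        using ideal.Icarr[OF J] y c ideal.I_l_closed[OF J, of f c]
        by (intro image_eqI[of _ _ "c \<otimes> f"]) (simp_all add: smult_assoc1)
    qed
  qed
  have Es: "submodule (?E m) R M" for m using zero_submodule img[OF H] by simp
  have Ec: "compatible_system R M I ?E"
    unfolding compatible_system_def
  proof (intro conjI allI ballI)
    fix m b x assume b: "b \<in> I" and x: "x \<in> ?E m"
    show "b \<odot>\<^bsub>M\<^esub> x \<in> ?E (Suc m)"
    proof (cases "m < k")
      case True
      then have "b \<odot>\<^bsub>M\<^esub> x = \<zero>\<^bsub>M\<^esub>" using x IR[OF b] by simp
      then show ?thesis using submodule_zero[OF Es[of "Suc m"]] by simp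
    next
      case False
      then obtain f where f: "f \<in> H (m - k)" "x = f \<odot>\<^bsub>M\<^esub> y" using x by auto
      have "b \<odot>\<^bsub>M\<^esub> x = (b \<otimes> f) \<odot>\<^bsub>M\<^esub> y" using f HR IR[OF b] y by (simp add: smult_assoc1)
      moreover have "b \<otimes> f \<in> H (Suc m - k)" using IH[OF b f(1)] False by (simp add: Suc_diff_le)
      ultimately show ?thesis using False by auto
    qed
  qed (rule Es)
  have EP: "?E m \<subseteq> P m" for m
    using submodule_zero[OF P] HP[of _ "m - k" y] by auto
  obtain n2 where n2: "\<And>m. m \<ge> n2 \<Longrightarrow> ?E (Suc m) \<subseteq> smult_span R M I (?E m)"
    using rees_noetherianD[of R M I P ?E, OF rP Ec EP] by blast
  have "H (Suc n) \<subseteq> I \<cdot> H n" if n: "n \<ge> max n1 n2" for n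
  proof
    fix f assume f: "f \<in> H (Suc n)"
    note IHn = ideal_prod_is_ideal[OF I H[of n]]
    have IHn_sub: "I \<cdot> H n \<subseteq> H (Suc n)" by (rule ideal_prod_subset[OF H IH])
    have "f \<odot>\<^bsub>M\<^esub> y \<in> ?E (Suc (n + k))" using f by auto
    also have "\<dots> \<subseteq> smult_span R M I (?E (n + k))" by (rule n2) (use n in simp)
    also have "\<dots> \<subseteq> (\<lambda>f. f \<odot>\<^bsub>M\<^esub> y) ` (I \<cdot> H n)"
    proof (rule smult_span_min[OF img[OF IHn]])
      fix b x assume b: "b \<in> I" and "x \<in> ?E (n + k)"
      then obtain g where g: "g \<in> H n" "x = g \<odot>\<^bsub>M\<^esub> y" by auto
      then have "b \<odot>\<^bsub>M\<^esub> x = (b \<otimes> g) \<odot>\<^bsub>M\<^esub> y" using HR IR[OF b] y by (simp add: smult_assoc1)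
      then show "b \<odot>\<^bsub>M\<^esub> x \<in> (\<lambda>f. f \<odot>\<^bsub>M\<^esub> y) ` (I \<cdot> H n)" using ideal_prod.prod[OF b g(1)] by blast
    qed
    finally obtain g where g: "g \<in> I \<cdot> H n" "f \<odot>\<^bsub>M\<^esub> y = g \<odot>\<^bsub>M\<^esub> y" by blast
    have gH: "g \<in> H (Suc n)" using g IHn_sub by blast
    have fg: "f \<in> carrier R" "g \<in> carrier R" using HR f gH by auto
    have "f \<ominus> g \<in> H (Suc n)"
      using additive_subgroup.a_closed[OF ideal.axioms(1)[OF H] f
          additive_subgroup.a_inv_closed[OF ideal.axioms(1)[OF H] gH]]
      by (simp add: a_minus_def)
    moreover have "(f \<ominus> g) \<odot>\<^bsub>M\<^esub> y = \<zero>\<^bsub>M\<^esub>"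
      using fg y g(2) by (simp add: a_minus_def smult_l_distr smult_l_minus M.r_neg)
    ultimately have "f \<ominus> g \<in> I \<cdot> ?K n" using n1[of n] n by auto
    also have "\<dots> \<subseteq> I \<cdot> H n"
      by (rule ideal_prod_subset[OF IHn]) (auto intro: ideal_prod.prod)
    finally have "(f \<ominus> g) \<oplus> g \<in> I \<cdot> H n"
      using additive_subgroup.a_closed[OF ideal.axioms(1)[OF IHn]] g(1) by blast
    moreover have "(f \<ominus> g) \<oplus> g = f" using fg by (simp add: a_minus_def R.a_assoc R.l_neg)
    ultimately show "f \<in> I \<cdot> H n" by simp
  qed
  then show ?case by blast
qed

lemma nonzerodivisor_pow_mult_eq_zero:
  fixes n :: nat
  assumes x: "nonzerodivisor R x" and f: "f \<in> carrier R"
  shows "(x [^] n) \<otimes> f = \<zero> \<Longrightarrow> f = \<zero>"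
proof (induction n)
  case 0
  then show ?case using f by simp
next
  case (Suc n)
  have xR: "x \<in> carrier R" using x by (simp add: nonzerodivisor_def)
  have "x \<otimes> ((x [^] n) \<otimes> f) = \<zero>"
    using Suc.prems xR f by (simp add: m_ac)
  then have "(x [^] n) \<otimes> f = \<zero>" using x xR f unfolding nonzerodivisor_def by simp
  then show ?case by (rule Suc.IH)
qed

lemma rr_filtration_eventually_equigenerated:
  assumes noeth: "noetherian_ring R" and fg: "fg_module R M"
    and reg: "regular_ideal R I" and ann: "ann R M = {\<zero>}"
  shows "\<exists>n0. \<forall>n\<ge>n0. rr_filtration R M I (Suc n) \<subseteq> I \<cdot> rr_filtration R M I n"
proof -
  let ?P = "ideal_pow_mod R M I"
  have I: "ideal I R" using reg by (simp add: regular_ideal_def)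
  obtain x where x: "x \<in> I" "nonzerodivisor R x" using reg unfolding regular_ideal_def by blast
  have xR: "x \<in> carrier R" using x ideal.Icarr[OF I] by blast
  have nM: "noetherian_module R M" by (rule noetherian_module_if_fg[OF noeth fg])
  obtain S where S: "finite S" "S \<subseteq> carrier M" "carrier M = gen_submodule R M S"
    using fg unfolding fg_module_def by blast
  obtain c where c: "\<And>n f y. f \<in> rr_filtration R M I n \<Longrightarrow> y \<in> ?P c \<Longrightarrow> f \<odot>\<^bsub>M\<^esub> y \<in> ?P (n + c)"
    using rr_filtration_uniform[OF noeth nM I] by blast
  \<comment> \<open>The factor \<open>x^c\<close> moves the generators into \<open>I^c M\<close>, where the uniform bound applies; as \<open>x\<close> is a
    nonzerodivisor, they still separate the elements of \<open>R\<close>.\<close>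
  let ?Y = "(\<lambda>s. (x [^] c) \<odot>\<^bsub>M\<^esub> s) ` S"
  have YP: "?Y \<subseteq> ?P c"
    by (rule image_subsetI, rule ideal_mod_gen[OF pow_mem_ideal_pow[OF I x(1)]]) (use S(2) in blast)
  show ?thesis
  proof (rule eventually_equigenerated_if_separated[where P = ?P and Y = ?Y and k = c
        and H = "rr_filtration R M I"])
    show "ideal I R" by (rule I)
    show "rees_noetherian R M I ?P" by (rule rees_noetherian_ideal_pow[OF noeth nM I])
    show "submodule (?P n) R M" for n by (rule pow_mod_submodule[OF I])
    show "ideal (rr_filtration R M I n) R" for n by (rule rr_filtration_ideal[OF I])
    show "b \<otimes> f \<in> rr_filtration R M I (Suc n)" if "b \<in> I" "f \<in> rr_filtration R M I n" for n b f
      by (rule smult_rr_filtration[OF I that])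
    show "finite ?Y" using S(1) by simp
    show "?Y \<subseteq> carrier M" using S(2) xR by auto
    show "f \<odot>\<^bsub>M\<^esub> y \<in> ?P (n + c)" if "f \<in> rr_filtration R M I n" "y \<in> ?Y" for n f y
      using c that YP by blast
    show "f = \<zero>" if f: "f \<in> rr_filtration R M I n" and fY: "\<forall>y\<in>?Y. f \<odot>\<^bsub>M\<^esub> y = \<zero>\<^bsub>M\<^esub>" for n f
    proof -
      let ?g = "(x [^] c) \<otimes> f"
      have fR: "f \<in> carrier R" using ideal.Icarr[OF rr_filtration_ideal[OF I] f] .
      have gR: "?g \<in> carrier R" using fR xR by simp
      have gS: "?g \<odot>\<^bsub>M\<^esub> s = \<zero>\<^bsub>M\<^esub>" if "s \<in> S" for s
      proof -
        have "s \<in> carrier M" using S(2) that by blast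
        then have "?g \<odot>\<^bsub>M\<^esub> s = f \<odot>\<^bsub>M\<^esub> ((x [^] c) \<odot>\<^bsub>M\<^esub> s)"
          using fR xR by (simp add: smult_assoc1[symmetric] m_comm)
        also have "\<dots> = \<zero>\<^bsub>M\<^esub>" by (rule bspec[OF fY imageI[OF that]])
        finally show ?thesis .
      qed
      have "gen_submodule R M S \<subseteq> {y \<in> carrier M. ?g \<odot>\<^bsub>M\<^esub> y \<in> {\<zero>\<^bsub>M\<^esub>}}"
        by (rule gen_submodule_min[OF submodule_vimage_smult[OF zero_submodule gR]])
          (use S(2) gS in blast)
      then have "carrier M \<subseteq> {y \<in> carrier M. ?g \<odot>\<^bsub>M\<^esub> y \<in> {\<zero>\<^bsub>M\<^esub>}}" by (simp only: S(3)[symmetric])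
      then have "?g \<in> ann R M" using gR unfolding ann_def by blast
      then have "?g = \<zero>" using ann by simp
      then show ?thesis by (rule nonzerodivisor_pow_mult_eq_zero[OF x(2) fR])
    qed
  qed
qed

end

theorem theorem5p9:
  fixes R :: "('a, 'c) ring_scheme" and M :: "('a, 'b, 'd) module_scheme" and I :: "'a set"
  assumes "cring R" and "noetherian_ring R"
    and "regular_ideal R I"
    and "fg_module R M"
    and "ann R M = {\<zero>\<^bsub>R\<^esub>}"
  shows "stable_filtration R I (rr_filtration R M I)"
proof -
  interpret module R M using assms(4) by (simp add: fg_module_def)
  have I: "ideal I R" using assms(3) by (simp add: regular_ideal_def)
  have le: "I \<cdot>\<^bsub>R\<^esub> rr_filtration R M I n \<subseteq> rr_filtration R M I (Suc n)" for n
    by (rule ideal_prod_subset[OF rr_filtration_ideal[OF I] smult_rr_filtration[OF I]])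
  obtain n0 where "\<forall>n\<ge>n0. rr_filtration R M I (Suc n) \<subseteq> I \<cdot>\<^bsub>R\<^esub> rr_filtration R M I n"
    using rr_filtration_eventually_equigenerated[OF assms(2,4,3,5)] by blast
  with le have "\<forall>n\<ge>n0. I \<cdot>\<^bsub>R\<^esub> rr_filtration R M I n = rr_filtration R M I (Suc n)" by blast
  then have "\<exists>n0. \<forall>n\<ge>n0. I \<cdot>\<^bsub>R\<^esub> rr_filtration R M I n = rr_filtration R M I (Suc n)" ..
  then show ?thesis
    unfolding stable_filtration_def
    by (intro conjI allI le rr_filtration_ideal[OF I] rr_filtration_0[OF I]
        rr_filtration_Suc_subset[OF I])
qed

end
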